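(* Let $H$ be a hexagonal system with a perfect matching. Then $H$ has no triphenylene as a nice subgraph if and only if for every perfect matching $M$ of $H$, $af(H,M)=fr(H,M)$.
   Context: A hexagonal system is a 2-connected finite plane graph in which every interior face is bounded by a regular hexagon of side length one (equivalently, a cycle of the infinite hexagonal lattice together with its interior); interior faces are called hexagons. A triphenylene is the hexagonal system consisting of a central hexagon $h$ together with three hexagons each sharing exactly one edge with $h$, these three shared edges being pairwise non-adjacent edges of $h$ (so the three outer hexagons are pairwise disjoint); "$H$ has a triphenylene as a subgraph" means four hexagons of $H$ form such a configuration. A subgraph $H_0$ of $H$ is nice if $H-V(H_0)$ has a perfect matching. For a perfect matching $M$, a cycle is $M$-alternating if its edges lie alternately in $M$ and outside $M$. A set $S\subseteq E(H)\setminus M$ is an anti-forcing set of $M$ if $H-S$ has $M$ as its unique perfect matching; $af(H,M)$ is the minimum size of such a set. $fr(H,M)$ is the number of $M$-alternating hexagons of $H$. *)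

theory Defs
  imports Main
begin

text \<open>
Model of the infinite hexagonal lattice.  Hexagons (faces) are indexed by their
centres, the points of the triangular lattice, written as pairs of integers
(a,b) (basis vectors at 60 degrees).  Vertices of the hexagonal lattice are the
triangles of the triangular lattice: (x,y,True) is the up-triangle with corners
(x,y),(x+1,y),(x,y+1) and (x,y,False) the down-triangle with corners
(x+1,y),(x,y+1),(x+1,y+1).  A lattice vertex lies on the three hexagons whose
centres are the corners of its triangle; two lattice vertices are adjacent iff
their triangles share a side.  Edges are represented as two-element vertex sets.
\<close>

type_synonym hvert = "int \<times> int \<times> bool"
type_synonym hcentre = "int \<times> int"

definition lat_edges :: "hvert set set" where
  "lat_edges = {{(x, y, True), (x', y', False)} | x y x' y'.
                  (x', y') \<in> {(x, y), (x - 1, y), (x, y - 1)}}"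

definition hexverts :: "hcentre \<Rightarrow> hvert set" where
  "hexverts c = (case c of (a, b) \<Rightarrow>
     {(a, b, True), (a - 1, b, True), (a, b - 1, True),
      (a - 1, b, False), (a, b - 1, False), (a - 1, b - 1, False)})"

text \<open>The six edges of the hexagon with centre c.\<close>
definition hexedges :: "hcentre \<Rightarrow> hvert set set" where
  "hexedges c = {e \<in> lat_edges. e \<subseteq> hexverts c}"

text \<open>Two hexagons are adjacent iff they share an edge.\<close>
definition hex_adj :: "hcentre \<Rightarrow> hcentre \<Rightarrow> bool" where
  "hex_adj p q \<longleftrightarrow> p \<noteq> q \<and> hexedges p \<inter> hexedges q \<noteq> {}"

definition hex_connected :: "hcentre set \<Rightarrow> bool" where
  "hex_connected S \<longleftrightarrow>
     (\<forall>p\<in>S. \<forall>q\<in>S. (p, q) \<in> {(u, v). u \<in> S \<and> v \<in> S \<and> hex_adj u v}\<^sup>*)"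

text \<open>A hexagonal system is given by its (finite, nonempty) set F of hexagons;
the condition that it is a cycle of the lattice together with its interior is
expressed by: F is connected (via shared edges) and its complement in the
lattice is connected (no holes).\<close>
definition hexsys :: "hcentre set \<Rightarrow> bool" where
  "hexsys F \<longleftrightarrow> finite F \<and> F \<noteq> {} \<and> hex_connected F \<and> hex_connected (- F)"

definition HV :: "hcentre set \<Rightarrow> hvert set" where
  "HV F = (\<Union>c\<in>F. hexverts c)"

definition HE :: "hcentre set \<Rightarrow> hvert set set" where
  "HE F = (\<Union>c\<in>F. hexedges c)"

text \<open>Generic graph notions for a graph with vertex set V and edge set E.\<close>
definition perfect_matching :: "'v set \<Rightarrow> 'v set set \<Rightarrow> 'v set set \<Rightarrow> bool" where
  "perfect_matching V E M \<longleftrightarrow> M \<subseteq> E \<and> (\<forall>v\<in>V. \<exists>!e. e \<in> M \<and> v \<in> e)"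

definition has_pm :: "'v set \<Rightarrow> 'v set set \<Rightarrow> bool" where
  "has_pm V E \<longleftrightarrow> (\<exists>M. perfect_matching V E M)"

text \<open>G - X for a vertex set X.\<close>
definition del_verts_V :: "'v set \<Rightarrow> 'v set \<Rightarrow> 'v set" where
  "del_verts_V V X = V - X"
definition del_verts_E :: "'v set set \<Rightarrow> 'v set \<Rightarrow> 'v set set" where
  "del_verts_E E X = {e \<in> E. e \<inter> X = {}}"

definition triphenylene :: "hcentre \<Rightarrow> hcentre \<Rightarrow> hcentre \<Rightarrow> hcentre \<Rightarrow> bool" where
  "triphenylene h h1 h2 h3 \<longleftrightarrow>
     (\<exists>e1 e2 e3. hexedges h \<inter> hexedges h1 = {e1} \<and>
                hexedges h \<inter> hexedges h2 = {e2} \<and>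
                hexedges h \<inter> hexedges h3 = {e3} \<and>
                e1 \<inter> e2 = {} \<and> e1 \<inter> e3 = {} \<and> e2 \<inter> e3 = {})"

definition has_nice_triphenylene :: "hcentre set \<Rightarrow> bool" where
  "has_nice_triphenylene F \<longleftrightarrow>
     (\<exists>h h1 h2 h3. h \<in> F \<and> h1 \<in> F \<and> h2 \<in> F \<and> h3 \<in> F \<and>
        triphenylene h h1 h2 h3 \<and>
        (let X = hexverts h \<union> hexverts h1 \<union> hexverts h2 \<union> hexverts h3 in
           has_pm (del_verts_V (HV F) X) (del_verts_E (HE F) X)))"

text \<open>The hexagon with centre c is M-alternating: consecutive (adjacent) edges
of the hexagon alternate between M and the complement of M.\<close>
definition alternating_hex :: "hvert set set \<Rightarrow> hcentre \<Rightarrow> bool" where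
  "alternating_hex M c \<longleftrightarrow>
     (\<forall>e1\<in>hexedges c. \<forall>e2\<in>hexedges c. e1 \<noteq> e2 \<and> e1 \<inter> e2 \<noteq> {} \<longrightarrow>
        (e1 \<in> M \<longleftrightarrow> e2 \<notin> M))"

definition fr :: "hcentre set \<Rightarrow> hvert set set \<Rightarrow> nat" where
  "fr F M = card {c \<in> F. alternating_hex M c}"

definition unique_pm :: "'v set \<Rightarrow> 'v set set \<Rightarrow> 'v set set \<Rightarrow> bool" where
  "unique_pm V E M \<longleftrightarrow> perfect_matching V E M \<and>
     (\<forall>M'. perfect_matching V E M' \<longrightarrow> M' = M)"

definition anti_forcing_set :: "hcentre set \<Rightarrow> hvert set set \<Rightarrow> hvert set set \<Rightarrow> bool" where
  "anti_forcing_set F M S \<longleftrightarrow> S \<subseteq> HE F - M \<and> unique_pm (HV F) (HE F - S) M"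

definition af :: "hcentre set \<Rightarrow> hvert set set \<Rightarrow> nat" where
  "af F M = (LEAST k. \<exists>S. anti_forcing_set F M S \<and> card S = k)"

end

theory Submission
  imports Defs
begin

text \<open>
A perfect matching deletes from the triangular lattice of hexagon centres, whose sides are oriented so
that every triangle is a directed cycle, exactly one side of each triangle meeting the system.  Contract
everything outside the system to one point.  The alternating cycles correspond to the directed cuts of
the remaining digraph of arcs, the alternating hexagons to its sources and sinks, and an anti-forcing set
to a set of arcs whose reversals make it strongly connected.  Sources and sinks have pairwise disjoint
sets of arcs, so \<open>af \<ge> fr\<close>; a central hexagon with three outer ones, matched so that only the perimeter
and the centre alternate, contributes one more disjoint directed cut, whence \<open>af > fr\<close>.

Conversely, sources and sinks can be treated separately.  Adding the reversal of one arc at each source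
greedily makes everything reachable from outside, unless a predecessor-closed set \<open>U\<close> is left all of whose
sources have all their out-neighbours in \<open>U\<close>.  Since the complement is connected, there is a height
function that grows by one along every arc.  Rotating the highest source of \<open>U\<close>, and discarding it together
with everything above the newly created sources, leaves a smaller set of the same kind; when only one
source is left, it is the centre of a nice triphenylene.
\<close>

subsection \<open>The dual triangular lattice\<close>

text \<open>The three steps sum to zero, so the sides of every triangle form a directed cycle.
  Around a hexagon, out-neighbours and in-neighbours alternate.\<close>

definition fwd :: "hcentre \<Rightarrow> hcentre \<Rightarrow> bool" where
  "fwd p q \<longleftrightarrow> q \<in> {(fst p + 1, snd p), (fst p - 1, snd p + 1), (fst p, snd p - 1)}"

text \<open>For adjacent hexagons this is their common edge. Writing it as an intersection makes it
  symmetric, so one term serves both directions of an arc.\<close>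

definition wall :: "hcentre \<Rightarrow> hcentre \<Rightarrow> hvert set" where
  "wall p q = hexverts p \<inter> hexverts q"

lemma fwd_out: "fwd (a, b) q \<longleftrightarrow> q = (a + 1, b) \<or> q = (a - 1, b + 1) \<or> q = (a, b - 1)"
  by (auto simp: fwd_def)

lemma fwd_in: "fwd q (a, b) \<longleftrightarrow> q = (a - 1, b) \<or> q = (a + 1, b - 1) \<or> q = (a, b + 1)"
  by (cases q) (auto simp: fwd_def)

lemma wall_commute: "wall p q = wall q p"
  by (auto simp: wall_def)

lemma hexverts_pair:
  "hexverts (a, b) = {(a, b, True), (a - 1, b, True), (a, b - 1, True),
      (a - 1, b, False), (a, b - 1, False), (a - 1, b - 1, False)}"
  by (simp add: hexverts_def)

lemma wall_east: "wall (a, b) (a + 1, b) = {(a, b, True), (a, b - 1, False)}"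
  and wall_northwest: "wall (a, b) (a - 1, b + 1) = {(a - 1, b, True), (a - 1, b, False)}"
  and wall_south: "wall (a, b) (a, b - 1) = {(a, b - 1, True), (a - 1, b - 1, False)}"
  by (auto simp: wall_def hexverts_pair)

lemma lat_edges_eq: "lat_edges = {wall p q | p q. fwd p q}"
proof (intro set_eqI iffI)
  fix e assume "e \<in> lat_edges"
  then obtain x y x' y' where e: "e = {(x, y, True), (x', y', False)}"
    and "(x', y') \<in> {(x, y), (x - 1, y), (x, y - 1)}"
    unfolding lat_edges_def by blast
  then consider "x' = x" "y' = y" | "x' = x - 1" "y' = y" | "x' = x" "y' = y - 1" by auto
  then show "e \<in> {wall p q | p q. fwd p q}"
  proof cases
    case 1
    have "e = wall (x + 1, y) (x, y + 1)" "fwd (x + 1, y) (x, y + 1)"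
      using wall_northwest[of "x + 1" y] e 1 by (auto simp: fwd_def)
    then show ?thesis by blast
  next
    case 2
    have "e = wall (x, y + 1) (x, y)" "fwd (x, y + 1) (x, y)"
      using wall_south[of x "y + 1"] e 2 by (auto simp: fwd_def)
    then show ?thesis by blast
  next
    case 3
    have "e = wall (x, y) (x + 1, y)" "fwd (x, y) (x + 1, y)"
      using wall_east[of x y] e 3 by (auto simp: fwd_def)
    then show ?thesis by blast
  qed
next
  fix e assume "e \<in> {wall p q | p q. fwd p q}"
  then obtain a b q where e: "e = wall (a, b) q" "fwd (a, b) q" by auto
  then consider "q = (a + 1, b)" | "q = (a - 1, b + 1)" | "q = (a, b - 1)"
    by (auto simp: fwd_out)
  then show "e \<in> lat_edges"
    by cases (auto simp: e wall_east wall_northwest wall_south lat_edges_def)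
qed

lemma wall_subset_hexverts:
  assumes "fwd p q"
  shows "wall p q \<subseteq> hexverts c \<longleftrightarrow> c = p \<or> c = q"
proof -
  obtain a b where p: "p = (a, b)" by (cases p)
  obtain x y where c: "c = (x, y)" by (cases c)
  from assms p consider "q = (a + 1, b)" | "q = (a - 1, b + 1)" | "q = (a, b - 1)"
    by (auto simp: fwd_out)
  then show ?thesis
    by cases (auto simp: p c wall_east wall_northwest wall_south hexverts_pair)
qed

lemma hexedges_eq: "hexedges c = {wall p q | p q. fwd p q \<and> (c = p \<or> c = q)}"
  unfolding hexedges_def lat_edges_eq using wall_subset_hexverts by blast

lemma fwd_asym: "fwd p q \<Longrightarrow> \<not> fwd q p"
  by (cases p; cases q) (auto simp: fwd_def)

lemma fwd_irrefl: "\<not> fwd p p"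
  by (cases p) (auto simp: fwd_def)

text \<open>A wall is contained in exactly two hexagons, which it therefore determines; asymmetry of
  \<open>fwd\<close> fixes their order.\<close>

lemma wall_inject:
  assumes "fwd p q" "fwd p' q'" "wall p q = wall p' q'"
  shows "p = p' \<and> q = q'"
proof -
  have "{p, q} = {p', q'}"
    using wall_subset_hexverts[OF assms(1)] wall_subset_hexverts[OF assms(2)] assms(3) by auto
  then show ?thesis
    using fwd_asym[OF assms(1)] assms(2) by (auto simp: doubleton_eq_iff)
qed

text \<open>The six triangles at a hexagon, one for each of its vertices.\<close>

lemma fwd_tri_cases:
  assumes "fwd (a, b) q" "fwd q r" "fwd r (a, b)"
  obtains "q = (a + 1, b)" "r = (a, b + 1)" | "q = (a + 1, b)" "r = (a + 1, b - 1)" |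
      "q = (a - 1, b + 1)" "r = (a, b + 1)" | "q = (a - 1, b + 1)" "r = (a - 1, b)" |
      "q = (a, b - 1)" "r = (a + 1, b - 1)" | "q = (a, b - 1)" "r = (a - 1, b)"
proof -
  have r: "r = (a - 1, b) \<or> r = (a + 1, b - 1) \<or> r = (a, b + 1)"
    using assms(3) unfolding fwd_in .
  consider "q = (a + 1, b)" | "q = (a - 1, b + 1)" | "q = (a, b - 1)"
    using assms(1) unfolding fwd_out by blast
  then show thesis
  proof cases
    case 1
    then have "r = (a + 1, b - 1) \<or> r = (a, b + 1)"
      using r assms(2) by (auto simp: fwd_out)
    then show thesis using 1 that by blast
  next
    case 2
    then have "r = (a - 1, b) \<or> r = (a, b + 1)"
      using r assms(2) by (auto simp: fwd_out)
    then show thesis using 2 that by blast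
  next
    case 3
    then have "r = (a - 1, b) \<or> r = (a + 1, b - 1)"
      using r assms(2) by (auto simp: fwd_out)
    then show thesis using 3 that by blast
  qed
qed

lemma fwd_tri_vertex:
  assumes "fwd p q" "fwd q r" "fwd r p"
  shows "\<exists>v. hexverts p \<inter> hexverts q \<inter> hexverts r = {v}"
proof -
  obtain a b where p: "p = (a, b)" by (cases p)
  show ?thesis
    using assms[unfolded p]
  proof (cases rule: fwd_tri_cases)
    case 1 then show ?thesis by (intro exI[of _ "(a, b, True)"]) (simp add: p hexverts_pair)
  next
    case 2 then show ?thesis by (intro exI[of _ "(a, b - 1, False)"]) (simp add: p hexverts_pair)
  next
    case 3 then show ?thesis by (intro exI[of _ "(a - 1, b, False)"]) (simp add: p hexverts_pair)
  next
    case 4 then show ?thesis by (intro exI[of _ "(a - 1, b, True)"]) (simp add: p hexverts_pair)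
  next
    case 5 then show ?thesis by (intro exI[of _ "(a, b - 1, True)"]) (simp add: p hexverts_pair)
  next
    case 6 then show ?thesis by (intro exI[of _ "(a - 1, b - 1, False)"]) (simp add: p hexverts_pair)
  qed
qed

lemma vertex_in_fwd_tri:
  assumes "v \<in> hexverts p"
  shows "\<exists>q r. fwd p q \<and> fwd q r \<and> fwd r p \<and> v \<in> hexverts q \<and> v \<in> hexverts r"
proof -
  obtain a b where p: "p = (a, b)" by (cases p)
  consider "v = (a, b, True)" | "v = (a - 1, b, True)" | "v = (a, b - 1, True)" |
    "v = (a - 1, b, False)" | "v = (a, b - 1, False)" | "v = (a - 1, b - 1, False)"
    using assms unfolding p hexverts_pair by blast
  then show ?thesis
  proof cases
    case 1 then show ?thesis
      by (intro exI[of _ "(a + 1, b)"] exI[of _ "(a, b + 1)"]) (simp add: p fwd_def hexverts_pair)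
  next
    case 2 then show ?thesis
      by (intro exI[of _ "(a - 1, b + 1)"] exI[of _ "(a - 1, b)"]) (simp add: p fwd_def hexverts_pair)
  next
    case 3 then show ?thesis
      by (intro exI[of _ "(a, b - 1)"] exI[of _ "(a + 1, b - 1)"]) (simp add: p fwd_def hexverts_pair)
  next
    case 4 then show ?thesis
      by (intro exI[of _ "(a - 1, b + 1)"] exI[of _ "(a, b + 1)"]) (simp add: p fwd_def hexverts_pair)
  next
    case 5 then show ?thesis
      by (intro exI[of _ "(a + 1, b)"] exI[of _ "(a + 1, b - 1)"]) (simp add: p fwd_def hexverts_pair)
  next
    case 6 then show ?thesis
      by (intro exI[of _ "(a, b - 1)"] exI[of _ "(a - 1, b)"]) (simp add: p fwd_def hexverts_pair)
  qed
qed

lemma hexes_at_vertex: "\<exists>a b c. {c. v \<in> hexverts c} = {a, b, c}"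
proof -
  obtain x y s where v: "v = (x, y, s)" by (cases v)
  show ?thesis
  proof (cases s)
    case True
    have "{c. v \<in> hexverts c} = {(x, y), (x + 1, y), (x, y + 1)}"
      unfolding v by (auto simp: True hexverts_def)
    then show ?thesis by blast
  next
    case False
    have "{c. v \<in> hexverts c} = {(x + 1, y), (x, y + 1), (x + 1, y + 1)}"
      unfolding v by (auto simp: False hexverts_def)
    then show ?thesis by blast
  qed
qed

text \<open>Reversing all arcs keeps every triangle cyclic and exchanges sources with sinks. Facts
  are proved once for sources and interpreted in both directions.\<close>

locale orientation =
  fixes fw :: "hcentre \<Rightarrow> hcentre \<Rightarrow> bool"
  assumes fw_cases: "fw = fwd \<or> fw = (\<lambda>p q. fwd q p)"
begin

lemma fw_asym:
  assumes "fw p q"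
  shows "\<not> fw q p"
proof
  assume "fw q p"
  then have "fwd p q \<and> fwd q p" using fw_cases assms by (elim disjE) simp_all
  then show False using fwd_asym by blast
qed

lemma fw_irrefl: "\<not> fw p p"
  using fw_cases by (elim disjE) (simp_all only: fwd_irrefl not_False_eq_True)

lemma wall_inj:
  assumes "fw p q" "fw p' q'" "wall p q = wall p' q'"
  shows "p = p' \<and> q = q'"
  using fw_cases
proof
  assume "fw = fwd" then show ?thesis using assms wall_inject by auto
next
  assume "fw = (\<lambda>p q. fwd q p)"
  then show ?thesis using assms wall_inject[of q p q' p'] by (auto simp: wall_commute)
qed

lemma lat_edges_fw: "lat_edges = {wall p q | p q. fw p q}"
  using fw_cases
proof
  assume "fw = fwd" then show ?thesis using lat_edges_eq by metis
next
  assume "fw = (\<lambda>p q. fwd q p)"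
  then show ?thesis unfolding lat_edges_eq using wall_commute by blast
qed

lemma hexedges_fw: "hexedges c = {wall p q | p q. fw p q \<and> (c = p \<or> c = q)}"
  using fw_cases
proof
  assume "fw = fwd" then show ?thesis using hexedges_eq by auto
next
  assume "fw = (\<lambda>p q. fwd q p)"
  then show ?thesis unfolding hexedges_eq using wall_commute by blast
qed

lemma HE_fw: "HE F = {wall p q | p q. fw p q \<and> (p \<in> F \<or> q \<in> F)}"
  unfolding HE_def hexedges_fw by blast

lemma wall_in_HE: "fw p q \<Longrightarrow> wall p q \<in> HE F \<longleftrightarrow> p \<in> F \<or> q \<in> F"
  unfolding HE_fw using wall_inj by blast

section \<open>Triangles of centres and the vertices they represent\<close>

definition tri :: "hcentre \<Rightarrow> hcentre \<Rightarrow> hcentre \<Rightarrow> bool" where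
  "tri p q r \<longleftrightarrow> fw p q \<and> fw q r \<and> fw r p"

lemma tri_rotate: "tri p q r \<Longrightarrow> tri q r p"
  by (auto simp: tri_def)

lemma tri_distinct:
  assumes "tri p q r"
  shows "p \<noteq> q" "q \<noteq> r" "p \<noteq> r" "\<not> fw q p" "\<not> fw r q" "\<not> fw p r"
    "\<not> fw p p" "\<not> fw q q" "\<not> fw r r"
  using assms fw_asym fw_irrefl unfolding tri_def by metis+

lemma tri_walls:
  assumes "tri p q r"
  shows "wall p q \<noteq> wall q r" "wall q r \<noteq> wall r p" "wall p q \<noteq> wall r p"
  using assms tri_distinct[OF assms] wall_inj[of p q q r] wall_inj[of q r r p] wall_inj[of p q r p]
  unfolding tri_def by blast+

lemma tri_vertex:
  assumes "tri p q r"
  obtains v where "hexverts p \<inter> hexverts q \<inter> hexverts r = {v}"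
proof -
  have "\<exists>v. hexverts p \<inter> hexverts q \<inter> hexverts r = {v}"
    using fw_cases
  proof
    assume "fw = fwd"
    then show ?thesis using assms fwd_tri_vertex unfolding tri_def by blast
  next
    assume "fw = (\<lambda>p q. fwd q p)"
    then have "\<exists>v. hexverts p \<inter> hexverts r \<inter> hexverts q = {v}"
      using assms fwd_tri_vertex unfolding tri_def by blast
    then show ?thesis by (simp add: Int_ac)
  qed
  then show thesis using that by blast
qed

lemma vertex_in_tri:
  assumes "v \<in> hexverts p"
  obtains q r where "tri p q r" "v \<in> hexverts q" "v \<in> hexverts r"
  using fw_cases
proof
  assume "fw = fwd"
  then show thesis using vertex_in_fwd_tri[OF assms] that unfolding tri_def by blast
next
  assume "fw = (\<lambda>p q. fwd q p)"
  then show thesis using vertex_in_fwd_tri[OF assms] that unfolding tri_def by blast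
qed

text \<open>A vertex lies on at most three hexagons, and a triangle already supplies three distinct
  ones.\<close>

lemma tri_hexes:
  assumes "tri p q r" "v \<in> hexverts p" "v \<in> hexverts q" "v \<in> hexverts r"
  shows "{c. v \<in> hexverts c} = {p, q, r}"
proof -
  have "card {p, q, r} = 3"
    using tri_distinct[OF assms(1)] by (simp add: card_insert_if)
  moreover obtain A B C where A: "{c. v \<in> hexverts c} = {A, B, C}"
    using hexes_at_vertex by blast
  moreover have "{p, q, r} \<subseteq> {A, B, C}" unfolding A[symmetric] using assms by simp
  moreover have "card {A, B, C} \<le> 3" by (simp add: card_insert_if)
  ultimately show ?thesis
    using card_seteq[of "{A, B, C}" "{p, q, r}"] by simp
qed

lemma edges_at_vertex:
  assumes "tri p q r" "v \<in> hexverts p" "v \<in> hexverts q" "v \<in> hexverts r"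
  shows "{e \<in> lat_edges. v \<in> e} = {wall p q, wall q r, wall r p}"
proof -
  have common: "c \<in> {p, q, r}" if "v \<in> hexverts c" for c
    using tri_hexes[OF assms] that by blast
  have wall_edge: "wall s t \<in> lat_edges" if "fw s t" for s t
    using that unfolding lat_edges_fw by blast
  have wall_eq: "v \<in> wall p q" "v \<in> wall q r" "v \<in> wall r p"
    using assms by (simp_all add: wall_def)
  show ?thesis
  proof (intro set_eqI iffI)
    fix e assume "e \<in> {e \<in> lat_edges. v \<in> e}"
    then obtain s t where e: "e = wall s t" "fw s t" and "v \<in> wall s t"
      unfolding lat_edges_fw by blast
    then have "v \<in> hexverts s" "v \<in> hexverts t" by (simp_all add: wall_def)
    then have "s \<in> {p, q, r}" "t \<in> {p, q, r}" using common by blast+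
    then have "(s = p \<and> t = q) \<or> (s = q \<and> t = r) \<or> (s = r \<and> t = p)"
      using e(2) tri_distinct[OF assms(1)] by (elim insertE emptyE) simp_all
    then show "e \<in> {wall p q, wall q r, wall r p}"
      unfolding e(1) by (elim disjE) simp_all
  next
    fix e assume "e \<in> {wall p q, wall q r, wall r p}"
    then show "e \<in> {e \<in> lat_edges. v \<in> e}"
      using assms(1) wall_eq wall_edge unfolding tri_def by (elim insertE emptyE) simp_all
  qed
qed

section \<open>Perfect matchings as a choice of one side in each triangle\<close>

definition one_wall :: "hvert set set \<Rightarrow> hcentre \<Rightarrow> hcentre \<Rightarrow> hcentre \<Rightarrow> bool" where
  "one_wall M p q r \<longleftrightarrow> (wall p q \<in> M \<and> wall q r \<notin> M \<and> wall r p \<notin> M) \<or>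
     (wall p q \<notin> M \<and> wall q r \<in> M \<and> wall r p \<notin> M) \<or>
     (wall p q \<notin> M \<and> wall q r \<notin> M \<and> wall r p \<in> M)"

lemma unique_edge_iff_one_wall:
  assumes "tri p q r" "v \<in> hexverts p" "v \<in> hexverts q" "v \<in> hexverts r" "M \<subseteq> lat_edges"
  shows "(\<exists>!e. e \<in> M \<and> v \<in> e) \<longleftrightarrow> one_wall M p q r"
proof -
  have *: "(e \<in> M \<and> v \<in> e) \<longleftrightarrow> (e \<in> M \<and> (e = wall p q \<or> e = wall q r \<or> e = wall r p))" for e
    using edges_at_vertex[OF assms(1-4)] assms(5) by blast
  have ex1: "(\<exists>!e. e \<in> M \<and> (e = A \<or> e = B \<or> e = C)) \<longleftrightarrow> (A \<in> M \<and> B \<notin> M \<and> C \<notin> M) \<or>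
     (A \<notin> M \<and> B \<in> M \<and> C \<notin> M) \<or> (A \<notin> M \<and> B \<notin> M \<and> C \<in> M)"
    if "A \<noteq> B" "B \<noteq> C" "A \<noteq> C" for A B C :: "hvert set"
    using that by (cases "A \<in> M"; cases "B \<in> M"; cases "C \<in> M") auto
  show ?thesis
    unfolding * one_wall_def using tri_walls[OF assms(1)] by (rule ex1)
qed

lemma HE_subset_lat: "HE F \<subseteq> lat_edges"
  by (auto simp: HE_def hexedges_def)

text \<open>The edges at a vertex are the three sides of its triangle. Since triangles may be
  rotated, it suffices to consider those whose first corner lies in \<open>F\<close>.\<close>

lemma perfect_matching_iff:
  "perfect_matching (HV F) (HE F) M \<longleftrightarrow>
     M \<subseteq> HE F \<and> (\<forall>p q r. tri p q r \<and> p \<in> F \<longrightarrow> one_wall M p q r)"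
proof (cases "M \<subseteq> HE F")
  case True
  then have lat: "M \<subseteq> lat_edges" using HE_subset_lat by blast
  have "(\<forall>v\<in>HV F. \<exists>!e. e \<in> M \<and> v \<in> e) \<longleftrightarrow> (\<forall>p q r. tri p q r \<and> p \<in> F \<longrightarrow> one_wall M p q r)"
  proof (intro iffI allI impI ballI)
    fix p q r assume *: "\<forall>v\<in>HV F. \<exists>!e. e \<in> M \<and> v \<in> e" "tri p q r \<and> p \<in> F"
    obtain v where "hexverts p \<inter> hexverts q \<inter> hexverts r = {v}"
      using * tri_vertex by blast
    then have v: "v \<in> hexverts p" "v \<in> hexverts q" "v \<in> hexverts r" by auto
    then show "one_wall M p q r"
      using unique_edge_iff_one_wall[OF _ v lat] * unfolding HV_def by blast
  next
    fix v assume *: "\<forall>p q r. tri p q r \<and> p \<in> F \<longrightarrow> one_wall M p q r" "v \<in> HV F"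
    then obtain p where p: "p \<in> F" "v \<in> hexverts p" by (auto simp: HV_def)
    then obtain q r where "tri p q r" "v \<in> hexverts q" "v \<in> hexverts r"
      using vertex_in_tri by blast
    then show "\<exists>!e. e \<in> M \<and> v \<in> e"
      using unique_edge_iff_one_wall[OF _ p(2) _ _ lat] * p by blast
  qed
  then show ?thesis using True by (simp add: perfect_matching_def)
qed (simp add: perfect_matching_def)

text \<open>The two triangles on either side of an arc. Most uses need only one of them;
  \<open>isolated_source_extra_wall\<close> needs both.\<close>

lemma ex_tri_out: assumes "fw p q" obtains r r' where "tri p q r" "tri p q r'" "r \<noteq> r'"
proof -
  have "\<exists>r r'. fwd p q \<longrightarrow> fwd q r \<and> fwd r p \<and> fwd q r' \<and> fwd r' p \<and> r \<noteq> r'" for p q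
  proof -
    obtain a b where p: "p = (a, b)" by (cases p)
    show ?thesis
    proof (cases "fwd p q")
      case True
      then consider "q = (a + 1, b)" | "q = (a - 1, b + 1)" | "q = (a, b - 1)"
        by (auto simp: fwd_out p)
      then show ?thesis
      proof cases
        case 1 then show ?thesis
          by (intro exI[of _ "(a, b + 1)"] exI[of _ "(a + 1, b - 1)"]) (auto simp: fwd_def p)
      next
        case 2 then show ?thesis
          by (intro exI[of _ "(a, b + 1)"] exI[of _ "(a - 1, b)"]) (auto simp: fwd_def p)
      next
        case 3 then show ?thesis
          by (intro exI[of _ "(a + 1, b - 1)"] exI[of _ "(a - 1, b)"]) (auto simp: fwd_def p)
      qed
    qed simp
  qed
  note * = this[of p q] this[of q p]
  show thesis
    using fw_cases
  proof
    assume "fw = fwd"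
    then show thesis using *(1) assms that unfolding tri_def by blast
  next
    assume "fw = (\<lambda>p q. fwd q p)"
    then show thesis using *(2) assms that unfolding tri_def by blast
  qed
qed

lemma finite_out: "finite {q. fw p q}"
proof -
  have "finite {q. fwd p q}" "finite {q. fwd q p}"
    by (cases p; simp add: fwd_out fwd_in)+
  then show ?thesis using fw_cases by auto
qed

end

interpretation forward: orientation fwd
  by (rule orientation.intro) blast

interpretation backward: orientation "\<lambda>p q. fwd q p"
  by (rule orientation.intro) blast

subsection \<open>Closed forms on the triangular lattice\<close>

text \<open>Only the values \<open>g p q\<close> with \<open>fwd p q\<close> matter; the three hexagons at a vertex form a directed triangle.\<close>

definition curl :: "(hcentre \<Rightarrow> hcentre \<Rightarrow> int) \<Rightarrow> hvert \<Rightarrow> int" where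
  "curl g v = (case v of (x, y, s) \<Rightarrow>
     if s then g (x, y) (x + 1, y) + g (x + 1, y) (x, y + 1) + g (x, y + 1) (x, y)
     else g (x, y + 1) (x + 1, y + 1) + g (x + 1, y + 1) (x + 1, y) + g (x + 1, y) (x, y + 1))"

lemma curl_up: "curl g (x, y, True) =
    g (x, y) (x + 1, y) + g (x + 1, y) (x, y + 1) + g (x, y + 1) (x, y)"
  and curl_down: "curl g (x, y, False) =
    g (x, y + 1) (x + 1, y + 1) + g (x + 1, y + 1) (x + 1, y) + g (x + 1, y) (x, y + 1)"
  by (simp_all add: curl_def)

lemma curl_triangle:
  obtains p q r where "fwd p q" "fwd q r" "fwd r p"
    "v \<in> hexverts p" "v \<in> hexverts q" "v \<in> hexverts r"
    "\<And>g. curl g v = g p q + g q r + g r p"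
proof -
  obtain x y s where v: "v = (x, y, s)" by (cases v)
  show thesis
  proof (cases s)
    case True
    show thesis
      by (rule that[of "(x, y)" "(x + 1, y)" "(x, y + 1)"])
        (simp_all add: v True fwd_def hexverts_pair curl_up)
  next
    case False
    show thesis
      by (rule that[of "(x, y + 1)" "(x + 1, y + 1)" "(x + 1, y)"])
        (simp_all add: v False fwd_def hexverts_pair curl_down)
  qed
qed

section \<open>Integration of curl-free forms\<close>

lemma int_antidifference:
  fixes f :: "int \<Rightarrow> int"
  obtains S where "\<And>x. S (x + 1) - S x = f x"
proof
  fix x :: int
  \<comment> \<open>One of the two sums is always empty: the first for negative \<open>x\<close>,
    the second otherwise.\<close>
  let ?S = "\<lambda>x. (\<Sum>i\<in>{0..<x}. f i) - (\<Sum>i\<in>{x..<0}. f i)"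
  show "?S (x + 1) - ?S x = f x"
  proof (cases "x \<ge> 0")
    case True
    then have "{0..<x + 1} = insert x {0..<x}" by auto
    then show ?thesis using True by simp
  next
    case False
    then have "{x..<0} = insert x {x + 1..<0}" by auto
    then show ?thesis using False by simp
  qed
qed

text \<open>A discrete Poincare lemma: integrate along row 0 and then along the columns. Vanishing
  curl carries the correct east differences from one row to the next.\<close>

lemma curl_free_imp_gradient:
  assumes "\<And>v. curl g v = 0"
  obtains \<phi> where "\<And>p q. fwd p q \<Longrightarrow> \<phi> q - \<phi> p = g p q"
proof -
  obtain S where S: "\<And>x. S (x + 1) - S x = g (x, 0) (x + 1, 0)"
    using int_antidifference[of "\<lambda>x. g (x, 0) (x + 1, 0)"] by blast
  have "\<forall>x. \<exists>T. \<forall>y. T (y + 1) - T y = - g (x, y + 1) (x, y)"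
  proof
    fix x
    show "\<exists>T. \<forall>y. T (y + 1) - T y = - g (x, y + 1) (x, y)"
      using int_antidifference[of "\<lambda>y. - g (x, y + 1) (x, y)"] by blast
  qed
  then obtain T where T: "\<And>x y. T x (y + 1) - T x y = - g (x, y + 1) (x, y)"
    by metis
  define \<phi> where "\<phi> p = S (fst p) + T (fst p) (snd p) - T (fst p) 0" for p :: hcentre
  have south: "\<phi> (x, y) - \<phi> (x, y + 1) = g (x, y + 1) (x, y)" for x y
    using T[of x y] by (simp add: \<phi>_def)
  have east: "\<phi> (x + 1, y) - \<phi> (x, y) = g (x, y) (x + 1, y)" for x y
  proof -
    \<comment> \<open>Subtracting the curls of the two triangles in a unit parallelogram cancels
      their common diagonal.\<close>
    have step: "\<phi> (x + 1, z + 1) - \<phi> (x, z + 1) - g (x, z + 1) (x + 1, z + 1) =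
        \<phi> (x + 1, z) - \<phi> (x, z) - g (x, z) (x + 1, z)" for z
      using assms[of "(x, z, True)"] assms[of "(x, z, False)"] south[of x z] south[of "x + 1" z]
      by (simp add: curl_up curl_down)
    have "\<phi> (x + 1, y) - \<phi> (x, y) - g (x, y) (x + 1, y) = 0"
    proof (induction y rule: int_induct[of _ 0])
      case base
      show ?case using S[of x] by (simp add: \<phi>_def)
    next
      case (step1 i)
      then show ?case using step[of i] by simp
    next
      case (step2 i)
      then show ?case using step[of "i - 1"] by simp
    qed
    then show ?thesis by simp
  qed
  have northwest: "\<phi> (x, y + 1) - \<phi> (x + 1, y) = g (x + 1, y) (x, y + 1)" for x y
    using assms[of "(x, y, True)"] south[of x y] east[of x y] by (simp add: curl_up)
  show thesis
  proof (rule that[of \<phi>])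
    fix p q assume "fwd p q"
    moreover obtain a b where p: "p = (a, b)" by (cases p)
    ultimately consider "q = (a + 1, b)" | "q = (a - 1, b + 1)" | "q = (a, b - 1)"
      by (auto simp: fwd_out)
    then show "\<phi> q - \<phi> p = g p q"
      using east[of a b] northwest[of "a - 1" b] south[of a "b - 1"]
      by cases (simp_all add: p)
  qed
qed

section \<open>Filling curl away from a set of hexagons\<close>

definition supported_off :: "hcentre set \<Rightarrow> (hcentre \<Rightarrow> hcentre \<Rightarrow> int) \<Rightarrow> bool" where
  "supported_off F g \<longleftrightarrow> (\<forall>p\<in>F. \<forall>q\<in>F. g p q = 0)"

text \<open>Subtracting a multiple of such a form removes the curl at \<open>v\<close> without
  changing any value on an arc inside \<open>F\<close>.\<close>

definition fillable :: "hcentre set \<Rightarrow> hvert \<Rightarrow> bool" where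
  "fillable F v \<longleftrightarrow> (\<exists>g. supported_off F g \<and> (\<forall>u. curl g u = (if u = v then 1 else 0)))"

text \<open>A unit on one arc has curl exactly at the two vertices of its wall. Subtracting a
  filling of one of them leaves a filling of the other, so fillability passes along any wall with a
  side outside \<open>F\<close>.\<close>

lemma fillable_single:
  assumes "fillable F u" "u \<noteq> v" "p \<notin> F \<or> q \<notin> F"
    and "\<And>w. curl (\<lambda>s t. if s = p \<and> t = q then 1 else 0) w = (if w = u \<or> w = v then 1 else 0)"
  shows "fillable F v"
proof -
  obtain g where g: "supported_off F g" "\<And>w. curl g w = (if w = u then 1 else 0)"
    using assms(1) unfolding fillable_def by blast
  define h where "h = (\<lambda>s t. if s = p \<and> t = q then 1 else (0 :: int))"
  have "curl (\<lambda>s t. h s t - g s t) w = curl h w - curl g w" for w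
    by (cases w) (simp add: curl_def)
  then have "curl (\<lambda>s t. h s t - g s t) w = (if w = v then 1 else 0)" for w
    using g(2)[of w] assms(2) assms(4)[of w] by (simp add: h_def)
  moreover have "supported_off F (\<lambda>s t. h s t - g s t)"
    using g(1) assms(3) by (auto simp: supported_off_def h_def)
  ultimately show ?thesis unfolding fillable_def by blast
qed

lemma curl_single_northwest:
  "curl (\<lambda>s t. if s = (x + 1, y) \<and> t = (x, y + 1) then 1 else 0) w =
     (if w = (x, y, True) \<or> w = (x, y, False) then 1 else 0)"
  and curl_single_east:
  "curl (\<lambda>s t. if s = (x, y) \<and> t = (x + 1, y) then 1 else 0) w =
     (if w = (x, y, True) \<or> w = (x, y - 1, False) then 1 else 0)"
  and curl_single_south:
  "curl (\<lambda>s t. if s = (x, y + 1) \<and> t = (x, y) then 1 else 0) w =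
     (if w = (x, y, True) \<or> w = (x - 1, y, False) then 1 else 0)"
  by (cases w; auto simp: curl_def)+

lemma fillable_northwest:
  assumes "(x + 1, y) \<notin> F \<or> (x, y + 1) \<notin> F"
  shows "fillable F (x, y, True) \<longleftrightarrow> fillable F (x, y, False)"
  using fillable_single[OF _ _ assms, of "(x, y, True)" "(x, y, False)"]
    fillable_single[OF _ _ assms, of "(x, y, False)" "(x, y, True)"]
  by (auto simp: curl_single_northwest)

lemma fillable_east:
  assumes "(x, y) \<notin> F \<or> (x + 1, y) \<notin> F"
  shows "fillable F (x, y, True) \<longleftrightarrow> fillable F (x, y - 1, False)"
  using fillable_single[OF _ _ assms, of "(x, y, True)" "(x, y - 1, False)"]
    fillable_single[OF _ _ assms, of "(x, y - 1, False)" "(x, y, True)"]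
  by (auto simp: curl_single_east)

lemma fillable_south:
  assumes "(x, y + 1) \<notin> F \<or> (x, y) \<notin> F"
  shows "fillable F (x, y, True) \<longleftrightarrow> fillable F (x - 1, y, False)"
  using fillable_single[OF _ _ assms, of "(x, y, True)" "(x - 1, y, False)"]
    fillable_single[OF _ _ assms, of "(x - 1, y, False)" "(x, y, True)"]
  by (auto simp: curl_single_south)

lemma fillable_around:
  assumes "p \<notin> F" "u \<in> hexverts p" "fillable F u" "v \<in> hexverts p"
  shows "fillable F v"
proof -
  obtain a b where p: "p = (a, b)" by (cases p)
  \<comment> \<open>Five of the six sides of the hexagon form a path through all its
    vertices.\<close>
  have "fillable F (a, b, True) \<longleftrightarrow> fillable F (a, b - 1, False)"
    "fillable F (a, b - 1, True) \<longleftrightarrow> fillable F (a, b - 1, False)"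
    "fillable F (a, b - 1, True) \<longleftrightarrow> fillable F (a - 1, b - 1, False)"
    "fillable F (a - 1, b, True) \<longleftrightarrow> fillable F (a - 1, b - 1, False)"
    "fillable F (a - 1, b, True) \<longleftrightarrow> fillable F (a - 1, b, False)"
    using assms(1) fillable_east[of a b F] fillable_northwest[of a "b - 1" F]
      fillable_south[of a "b - 1" F] fillable_east[of "a - 1" b F] fillable_northwest[of "a - 1" b F]
    by (simp_all add: p)
  then show ?thesis
    using assms(2-4) unfolding p hexverts_pair by auto
qed

lemma hex_adj_fwd: "hex_adj p q \<longleftrightarrow> fwd p q \<or> fwd q p"
proof
  assume "hex_adj p q"
  then obtain e where "p \<noteq> q" "e \<in> hexedges p" "e \<in> hexedges q"
    unfolding hex_adj_def by blast
  then obtain s t where "fwd s t" "e = wall s t" "p = s \<or> p = t"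
    unfolding hexedges_eq by blast
  moreover have "e \<subseteq> hexverts q" using \<open>e \<in> hexedges q\<close> by (simp add: hexedges_def)
  ultimately show "fwd p q \<or> fwd q p"
    using wall_subset_hexverts[of s t q] \<open>p \<noteq> q\<close> by blast
next
  assume "fwd p q \<or> fwd q p"
  moreover have "p \<noteq> q" using calculation fwd_irrefl by blast
  ultimately show "hex_adj p q"
    unfolding hex_adj_def hexedges_eq using wall_commute by blast
qed

lemma hex_connected_induct:
  assumes "hex_connected S" "p \<in> S" "q \<in> S" "P p"
    and step: "\<And>s t. s \<in> S \<Longrightarrow> t \<in> S \<Longrightarrow> fwd s t \<or> fwd t s \<Longrightarrow> P s \<Longrightarrow> P t"
  shows "P q"
proof -
  have "(p, q) \<in> {(u, v). u \<in> S \<and> v \<in> S \<and> hex_adj u v}\<^sup>*"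
    using assms(1-3) unfolding hex_connected_def by blast
  then show ?thesis
  proof (induction rule: rtrancl_induct)
    case base
    show ?case by (rule assms(4))
  next
    case (step y z)
    then have "y \<in> S" "z \<in> S" "fwd y z \<or> fwd z y" "P y" by (simp_all add: hex_adj_fwd)
    then show ?case by (rule assms(5))
  qed
qed

lemma wall_nonempty:
  assumes "fwd p q"
  shows "wall p q \<noteq> {}"
proof -
  obtain a b where p: "p = (a, b)" by (cases p)
  consider "q = (a + 1, b)" | "q = (a - 1, b + 1)" | "q = (a, b - 1)"
    using assms unfolding p fwd_out by blast
  then show ?thesis
    by cases (simp_all add: p wall_east wall_northwest wall_south)
qed

text \<open>A unit of curl at a vertex on the boundary of the complement is pushed to infinity along the
  complement, and then along a horizontal ray beyond the finite set.\<close>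

lemma fillable_outside:
  assumes "finite F" "hex_connected (- F)" "p \<notin> F" "v \<in> hexverts p"
  shows "fillable F v"
proof -
  have "finite (insert 0 (fst ` F))" using assms(1) by simp
  then obtain m where m: "\<And>x. x \<in> insert 0 (fst ` F) \<Longrightarrow> x < m"
    using Max_ge[of "insert 0 (fst ` F)"] by (metis le_less_trans less_add_one)
  have F: "(x, y) \<notin> F" if "x \<ge> m" for x y
  proof
    assume "(x, y) \<in> F"
    then have "x \<in> insert 0 (fst ` F)" by force
    then show False using m[of x] that by simp
  qed
  \<comment> \<open>The strip between rows 0 and 1, from column \<open>m\<close> on: northwest arcs
    carry 1 and south arcs -1, so the curl cancels in each triangle. The south arc in column
    \<open>m\<close> is omitted, which leaves one unit at the left end. All arcs used lie beyond
    \<open>F\<close>.\<close>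
  define g :: "hcentre \<Rightarrow> hcentre \<Rightarrow> int" where "g = (\<lambda>s t.
      if snd t = 1 \<and> fst t \<ge> m \<and> snd s = 0 \<and> fst s = fst t + 1 then 1
      else if snd s = 1 \<and> fst s > m \<and> t = (fst s, 0) then - 1 else 0)"
  have "supported_off F g"
    unfolding supported_off_def g_def using F by (auto simp: not_less)
  moreover have "curl g u = (if u = (m, 0, True) then 1 else 0)" for u
    by (cases u) (auto simp: curl_def g_def)
  ultimately have far: "fillable F (m, 0, True)"
    unfolding fillable_def by blast
  have m0: "(m, 0) \<notin> F" using F[of m 0] by blast
  have corner: "(m, 0, True) \<in> hexverts (m, 0)" by (simp add: hexverts_pair)
  have "\<forall>v\<in>hexverts p. fillable F v"
  proof (rule hex_connected_induct[OF assms(2), of "(m, 0)"])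
    show "\<forall>v\<in>hexverts (m, 0). fillable F v"
      using fillable_around[OF m0 corner far] by blast
  next
    fix s t assume st: "s \<in> - F" "t \<in> - F" "fwd s t \<or> fwd t s" "\<forall>v\<in>hexverts s. fillable F v"
    obtain u where "u \<in> hexverts s" "u \<in> hexverts t"
      using st(3) wall_nonempty[of s t] wall_nonempty[of t s] unfolding wall_def by blast
    then show "\<forall>v\<in>hexverts t. fillable F v"
      using st fillable_around[of t F u] by blast
  qed (use assms(3) m0 in blast)+
  then show ?thesis using assms(4) by blast
qed

text \<open>Extended by zero, the form has curl only at vertices with hexagons both inside and
  outside \<open>F\<close>. These are fillable because the complement is connected, and subtracting
  the fillings yields a curl-free form that is unchanged inside \<open>F\<close>.\<close>

lemma closed_form_extends:
  assumes "finite F" "hex_connected (- F)"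
    and closed: "\<And>p q r. p \<in> F \<Longrightarrow> q \<in> F \<Longrightarrow> r \<in> F \<Longrightarrow> fwd p q \<Longrightarrow> fwd q r \<Longrightarrow> fwd r p \<Longrightarrow>
      g p q + g q r + g r p = 0"
  obtains \<phi> where "\<And>p q. p \<in> F \<Longrightarrow> q \<in> F \<Longrightarrow> fwd p q \<Longrightarrow> \<phi> q - \<phi> p = (g p q :: int)"
proof -
  define g0 where "g0 p q = (if p \<in> F \<and> q \<in> F then g p q else 0)" for p q
  define K where "K = {v. curl g0 v \<noteq> 0}"
  have K: "v \<in> HV F \<and> fillable F v" if "v \<in> K" for v
  proof -
    obtain p q r where t: "fwd p q" "fwd q r" "fwd r p" "v \<in> hexverts p" "v \<in> hexverts q"
      "v \<in> hexverts r" "\<And>g. curl g v = g p q + g q r + g r p"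
      using curl_triangle[of v] by metis
    have "p \<in> F \<or> q \<in> F \<or> r \<in> F"
      using that t(7)[of g0] unfolding K_def g0_def by (auto split: if_splits)
    moreover have "p \<notin> F \<or> q \<notin> F \<or> r \<notin> F"
      using that t(7)[of g0] closed[of p q r] t(1-3) unfolding K_def g0_def by auto
    ultimately show ?thesis
      using t(4-6) fillable_outside[OF assms(1,2)] unfolding HV_def by blast
  qed
  have "finite (HV F)"
    using assms(1) unfolding HV_def by (auto simp: hexverts_def)
  then have "finite K" using K by (meson finite_subset subsetI)
  obtain \<eta> where \<eta>: "\<And>v. v \<in> K \<Longrightarrow> supported_off F (\<eta> v)"
      "\<And>v u. v \<in> K \<Longrightarrow> curl (\<eta> v) u = (if u = v then 1 else 0)"
    using K unfolding fillable_def by metis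
  define g1 where "g1 p q = g0 p q - (\<Sum>v\<in>K. curl g0 v * \<eta> v p q)" for p q
  have "curl g1 u = 0" for u
  proof -
    obtain p q r where t: "\<And>g. curl g u = g p q + g q r + g r p"
      using curl_triangle[of u] by metis
    have "curl g1 u = curl g0 u - (\<Sum>v\<in>K. curl g0 v * curl (\<eta> v) u)"
      unfolding t g1_def by (simp add: distrib_left sum.distrib)
    also have "(\<Sum>v\<in>K. curl g0 v * curl (\<eta> v) u) = (\<Sum>v\<in>K. if v = u then curl g0 v else 0)"
      by (rule sum.cong) (auto simp: \<eta>(2))
    also have "\<dots> = curl g0 u"
      using \<open>finite K\<close> by (simp add: K_def)
    finally show ?thesis by simp
  qed
  then obtain \<phi> where \<phi>: "\<And>p q. fwd p q \<Longrightarrow> \<phi> q - \<phi> p = g1 p q"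
    using curl_free_imp_gradient[of g1] by blast
  have "g1 p q = g p q" if "p \<in> F" "q \<in> F" for p q
    using that \<eta>(1) unfolding g1_def g0_def supported_off_def by simp
  then show thesis using that[of \<phi>] \<phi> by simp
qed

subsection \<open>Sources, sinks and directed cuts\<close>

text \<open>Between two in-neighbours of \<open>c\<close> around the hexagon lies an out-neighbour
  adjacent to both.\<close>

lemma fwd_in_linked:
  assumes "fwd r c" "fwd r' c" "r \<noteq> r'"
  shows "\<exists>q. fwd c q \<and> fwd q r \<and> fwd q r'"
proof -
  obtain a b where c: "c = (a, b)" by (cases c)
  have "r = (a - 1, b) \<or> r = (a + 1, b - 1) \<or> r = (a, b + 1)"
    "r' = (a - 1, b) \<or> r' = (a + 1, b - 1) \<or> r' = (a, b + 1)"
    using assms(1,2) unfolding c fwd_in by blast+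
  moreover have "fwd c (a + 1, b)" "fwd (a + 1, b) (a, b + 1)" "fwd (a + 1, b) (a + 1, b - 1)"
    "fwd c (a - 1, b + 1)" "fwd (a - 1, b + 1) (a, b + 1)" "fwd (a - 1, b + 1) (a - 1, b)"
    "fwd c (a, b - 1)" "fwd (a, b - 1) (a + 1, b - 1)" "fwd (a, b - 1) (a - 1, b)"
    by (simp_all add: c fwd_def)
  ultimately show ?thesis using assms(3) by metis
qed

lemma fwd_out_linked:
  assumes "fwd c r" "fwd c r'" "r \<noteq> r'"
  shows "\<exists>q. fwd q c \<and> fwd r q \<and> fwd r' q"
proof -
  obtain a b where c: "c = (a, b)" by (cases c)
  have "r = (a + 1, b) \<or> r = (a - 1, b + 1) \<or> r = (a, b - 1)"
    "r' = (a + 1, b) \<or> r' = (a - 1, b + 1) \<or> r' = (a, b - 1)"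
    using assms(1,2) unfolding c fwd_out by blast+
  moreover have "fwd (a, b + 1) c" "fwd (a + 1, b) (a, b + 1)" "fwd (a - 1, b + 1) (a, b + 1)"
    "fwd (a + 1, b - 1) c" "fwd (a + 1, b) (a + 1, b - 1)" "fwd (a, b - 1) (a + 1, b - 1)"
    "fwd (a - 1, b) c" "fwd (a - 1, b + 1) (a - 1, b)" "fwd (a, b - 1) (a - 1, b)"
    by (simp_all add: c fwd_def)
  ultimately show ?thesis using assms(3) by metis
qed

lemma finite_HE: "finite F \<Longrightarrow> finite (HE F)"
proof -
  assume "finite F"
  moreover have "finite (hexedges c)" for c
    by (rule finite_subset[of _ "Pow (hexverts c)"], use hexedges_def in blast)
      (cases c; simp add: hexverts_pair)
  ultimately show ?thesis by (simp add: HE_def)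
qed

lemma perfect_matching_Diff:
  "perfect_matching V (E - S) M \<longleftrightarrow> perfect_matching V E M \<and> M \<inter> S = {}"
  by (auto simp: perfect_matching_def)

section \<open>Alternating hexagons and rotations of a matching\<close>

context orientation
begin

lemma in_linked:
  assumes "fw r c" "fw r' c" "r \<noteq> r'"
  obtains q where "tri c q r" "tri c q r'"
  using fw_cases
proof
  assume "fw = fwd"
  then show thesis using fwd_in_linked[of r c r'] assms that unfolding tri_def by blast
next
  assume fw: "fw = (\<lambda>p q. fwd q p)"
  then show thesis using fwd_out_linked[of c r r'] assms that unfolding tri_def by blast
qed

definition source :: "hvert set set \<Rightarrow> hcentre \<Rightarrow> bool" where
  "source M p \<longleftrightarrow> (\<forall>q. fw q p \<longrightarrow> wall q p \<in> M)"

definition sink :: "hvert set set \<Rightarrow> hcentre \<Rightarrow> bool" where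
  "sink M p \<longleftrightarrow> (\<forall>q. fw p q \<longrightarrow> wall p q \<in> M)"

lemma one_wall_if_perfect_matching:
  assumes "perfect_matching (HV F) (HE F) M" "tri p q r" "p \<in> F \<or> q \<in> F \<or> r \<in> F"
  shows "one_wall M p q r"
proof -
  have "one_wall M p q r \<or> one_wall M q r p \<or> one_wall M r p q"
    using assms tri_rotate unfolding perfect_matching_iff by blast
  then show ?thesis unfolding one_wall_def by blast
qed

lemma source_out:
  assumes "perfect_matching (HV F) (HE F) M" "p \<in> F" "source M p" "fw p q"
  shows "wall p q \<notin> M"
proof -
  obtain r where "tri p q r" using ex_tri_out[OF assms(4)] .
  then show ?thesis
    using one_wall_if_perfect_matching[OF assms(1)] assms(2,3)
    unfolding source_def one_wall_def tri_def by blast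
qed

lemma sink_in:
  assumes "perfect_matching (HV F) (HE F) M" "p \<in> F" "sink M p" "fw q p"
  shows "wall q p \<notin> M"
proof -
  obtain r where "tri q p r" using ex_tri_out[OF assms(4)] .
  then show ?thesis
    using one_wall_if_perfect_matching[OF assms(1)] assms(2,3)
    unfolding sink_def one_wall_def tri_def by blast
qed

lemma hexedges_meet:
  assumes "e1 \<in> hexedges c" "e2 \<in> hexedges c" "e1 \<noteq> e2" "e1 \<inter> e2 \<noteq> {}"
  obtains q r where "tri c q r" "(e1 = wall c q \<and> e2 = wall r c) \<or> (e2 = wall c q \<and> e1 = wall r c)"
proof -
  obtain v where v: "v \<in> e1" "v \<in> e2" using assms(4) by blast
  then have "v \<in> hexverts c" using assms(1) by (auto simp: hexedges_def)
  then obtain q r where t: "tri c q r" "v \<in> hexverts q" "v \<in> hexverts r"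
    using vertex_in_tri by blast
  have "wall q r \<notin> hexedges c"
  proof
    assume "wall q r \<in> hexedges c"
    then obtain s t where "fw s t" "c = s \<or> c = t" "wall q r = wall s t"
      unfolding hexedges_fw by blast
    then have "c = q \<or> c = r" using wall_inj t(1) unfolding tri_def by blast
    then show False using tri_distinct[OF t(1)] by blast
  qed
  moreover have "e1 \<in> {wall c q, wall q r, wall r c}" "e2 \<in> {wall c q, wall q r, wall r c}"
    unfolding edges_at_vertex[OF t(1) \<open>v \<in> hexverts c\<close> t(2,3), symmetric]
    using assms(1,2) v by (simp_all add: hexedges_def)
  ultimately show thesis using that[OF t(1)] assms(1-3) by blast
qed

text \<open>Walls to in- and out-neighbours alternate around \<open>c\<close>. Two incoming walls
  are each next to a common outgoing one, so alternation gives all incoming walls the same status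
  and all outgoing walls the opposite one.\<close>

lemma alternating_hex_iff:
  assumes M: "perfect_matching (HV F) (HE F) M" and c: "c \<in> F"
  shows "alternating_hex M c \<longleftrightarrow> source M c \<or> sink M c"
proof
  assume alt: "alternating_hex M c"
  have sw: "wall c q \<in> M \<longleftrightarrow> wall r c \<notin> M" if t: "tri c q r" for q r
  proof -
    obtain v where "hexverts c \<inter> hexverts q \<inter> hexverts r = {v}"
      using tri_vertex[OF t] .
    then have "wall c q \<inter> wall r c \<noteq> {}" unfolding wall_def by blast
    moreover have "wall c q \<in> hexedges c" "wall r c \<in> hexedges c"
      using t unfolding hexedges_fw tri_def by blast+
    ultimately show ?thesis
      using alt tri_walls(3)[OF t] unfolding alternating_hex_def by blast
  qed
  have link: "wall r c \<in> M \<longleftrightarrow> wall r' c \<in> M" if r: "fw r c" "fw r' c" for r r'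
  proof (cases "r = r'")
    case False
    obtain q where "tri c q r" "tri c q r'" using in_linked[OF r False] .
    then show ?thesis using sw by blast
  qed simp
  show "source M c \<or> sink M c"
  proof (cases "source M c")
    case False
    then obtain r where r: "fw r c" "wall r c \<notin> M" unfolding source_def by blast
    have "wall c q \<in> M" if q: "fw c q" for q
    proof -
      obtain r' where "tri c q r'" using ex_tri_out[OF q] .
      then show ?thesis using sw link[of r r'] r unfolding tri_def by blast
    qed
    then show ?thesis unfolding sink_def by blast
  qed simp
next
  assume s: "source M c \<or> sink M c"
  show "alternating_hex M c"
    unfolding alternating_hex_def
  proof (intro ballI impI)
    fix e1 e2 assume e: "e1 \<in> hexedges c" "e2 \<in> hexedges c" "e1 \<noteq> e2 \<and> e1 \<inter> e2 \<noteq> {}"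
    then obtain q r where t: "tri c q r"
        "(e1 = wall c q \<and> e2 = wall r c) \<or> (e2 = wall c q \<and> e1 = wall r c)"
      using hexedges_meet[of e1 c e2] by blast
    have "wall c q \<in> M \<longleftrightarrow> wall r c \<notin> M"
      using s
    proof
      assume "source M c"
      then show ?thesis using source_out[OF M c, of q] t(1) unfolding source_def tri_def by blast
    next
      assume "sink M c"
      then show ?thesis using sink_in[OF M c, of r] t(1) unfolding sink_def tri_def by blast
    qed
    then show "e1 \<in> M \<longleftrightarrow> e2 \<notin> M" using t(2) by blast
  qed
qed

text \<open>The matching alternates along the boundary of a set \<open>U\<close> of hexagons precisely if all walls
  leading into \<open>U\<close> are matched (or all those leading out); rotating \<open>M\<close> along that boundary exchanges
  the two kinds of walls.\<close>

definition pred_closed :: "hvert set set \<Rightarrow> hcentre set \<Rightarrow> bool" where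
  "pred_closed M U \<longleftrightarrow> (\<forall>p q. fw p q \<and> q \<in> U \<and> p \<notin> U \<longrightarrow> wall p q \<in> M)"

definition flip :: "hvert set set \<Rightarrow> hcentre set \<Rightarrow> hvert set set" where
  "flip M U = (M - {wall p q | p q. fw p q \<and> p \<notin> U \<and> q \<in> U}) \<union> {wall p q | p q. fw p q \<and> p \<in> U \<and> q \<notin> U}"

lemma wall_in_flip:
  assumes "fw p q"
  shows "wall p q \<in> flip M U \<longleftrightarrow> (if p \<in> U \<longleftrightarrow> q \<in> U then wall p q \<in> M else p \<in> U)"
proof -
  have "wall p q \<in> {wall p q | p q. fw p q \<and> p \<notin> U \<and> q \<in> U} \<longleftrightarrow> p \<notin> U \<and> q \<in> U"
    "wall p q \<in> {wall p q | p q. fw p q \<and> p \<in> U \<and> q \<notin> U} \<longleftrightarrow> p \<in> U \<and> q \<notin> U"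
    using assms wall_inj by blast+
  then show ?thesis unfolding flip_def by auto
qed

text \<open>A cyclic triangle with corners on both sides of \<open>U\<close> has exactly one
  entering and one leaving wall. The entering one is its matched wall, so exchanging the two again
  leaves one.\<close>

lemma perfect_matching_flip:
  assumes "perfect_matching (HV F) (HE F) M" "U \<subseteq> F" "pred_closed M U"
  shows "perfect_matching (HV F) (HE F) (flip M U)"
  unfolding perfect_matching_iff
proof (intro conjI allI impI)
  show "flip M U \<subseteq> HE F"
  proof
    fix e assume e: "e \<in> flip M U"
    show "e \<in> HE F"
    proof (cases "e \<in> M")
      case True
      then show ?thesis using assms(1) unfolding perfect_matching_def by blast
    next
      case False
      then show ?thesis using e assms(2) wall_in_HE unfolding flip_def by blast
    qed
  qed
next
  fix p q r assume t: "tri p q r \<and> p \<in> F"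
  then have fw: "fw p q" "fw q r" "fw r p" unfolding tri_def by auto
  have "one_wall M p q r" using t assms(1) unfolding perfect_matching_iff by blast
  moreover have "q \<in> U \<Longrightarrow> p \<notin> U \<Longrightarrow> wall p q \<in> M" "r \<in> U \<Longrightarrow> q \<notin> U \<Longrightarrow> wall q r \<in> M"
    "p \<in> U \<Longrightarrow> r \<notin> U \<Longrightarrow> wall r p \<in> M"
    using fw assms(3) unfolding pred_closed_def by blast+
  ultimately show "one_wall (flip M U) p q r"
    unfolding one_wall_def wall_in_flip[OF fw(1)] wall_in_flip[OF fw(2)] wall_in_flip[OF fw(3)]
    by (cases "p \<in> U"; cases "q \<in> U"; cases "r \<in> U") auto
qed

text \<open>A triangle that leaves \<open>U\<close> must also enter it, and the entering wall is
  already its matched one.\<close>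

lemma leaving_wall_unmatched:
  assumes "perfect_matching (HV F) (HE F) M" "U \<subseteq> F" "pred_closed M U" "fw p q" "p \<in> U" "q \<notin> U"
  shows "wall p q \<notin> M"
proof -
  obtain r where t: "tri p q r" using ex_tri_out[OF assms(4)] .
  then have "one_wall M p q r"
    using one_wall_if_perfect_matching assms(1,2,5) by blast
  then show ?thesis
    using t assms(3,5,6) unfolding one_wall_def tri_def pred_closed_def by blast
qed

lemma ex_leaving_wall:
  assumes "finite U" "U \<noteq> {}"
  obtains p q where "fw p q" "p \<in> U" "q \<notin> U"
proof -
  have fin: "finite (fst ` U)" "fst ` U \<noteq> {}" using assms by auto
  \<comment> \<open>A rightmost hexagon has an arc leaving \<open>U\<close> in the forward
    orientation, a leftmost one in the backward orientation.\<close>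
  obtain p where p: "p \<in> U" "fst p = Max (fst ` U)"
    using Max_in[OF fin] by (metis imageE)
  obtain p' where p': "p' \<in> U" "fst p' = Min (fst ` U)"
    using Min_in[OF fin] by (metis imageE)
  have 1: "(fst p + 1, snd p) \<notin> U"
  proof
    assume "(fst p + 1, snd p) \<in> U"
    then have "fst (fst p + 1, snd p) \<in> fst ` U" by (rule imageI)
    then show False using Max_ge[OF fin(1)] p(2) by fastforce
  qed
  have 2: "(fst p' - 1, snd p') \<notin> U"
  proof
    assume "(fst p' - 1, snd p') \<in> U"
    then have "fst (fst p' - 1, snd p') \<in> fst ` U" by (rule imageI)
    then show False using Min_le[OF fin(1)] p'(2) by fastforce
  qed
  have "fwd p (fst p + 1, snd p)" "fwd (fst p' - 1, snd p') p'" by (simp_all add: fwd_def)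
  then show thesis using fw_cases p(1) p'(1) 1 2 that by (elim disjE) simp_all
qed

text \<open>Rotating \<open>M\<close> along the boundary of \<open>U\<close> gives a different
  perfect matching whose only new edges are the leaving walls. Deleting \<open>S\<close> must
  destroy it.\<close>

lemma anti_forcing_set_hits:
  assumes S: "anti_forcing_set F M S" and U: "finite U" "U \<noteq> {}" "U \<subseteq> F" "pred_closed M U"
  obtains p q where "fw p q" "p \<in> U" "q \<notin> U" "wall p q \<in> S"
proof (rule ccontr)
  assume "\<not> thesis"
  then have none: "\<not> (fw p q \<and> p \<in> U \<and> q \<notin> U \<and> wall p q \<in> S)" for p q using that by blast
  have M: "perfect_matching (HV F) (HE F) M" "M \<inter> S = {}"
    and uniq: "\<And>M'. perfect_matching (HV F) (HE F) M' \<Longrightarrow> M' \<inter> S = {} \<Longrightarrow> M' = M"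
    using S unfolding anti_forcing_set_def unique_pm_def perfect_matching_Diff by blast+
  have "flip M U \<inter> S = {}" unfolding flip_def using M(2) none by blast
  then have "flip M U = M" using uniq perfect_matching_flip[OF M(1) U(3,4)] by blast
  moreover obtain p q where pq: "fw p q" "p \<in> U" "q \<notin> U" using ex_leaving_wall[OF U(1,2)] .
  ultimately show False
    using leaving_wall_unmatched[OF M(1) U(3,4) pq] wall_in_flip[OF pq(1), of M U] pq(2,3) by simp
qed

text \<open>If the wall were unmatched, \<open>c\<close> would be a source and \<open>c'\<close> a
  sink, and a triangle on this wall would have two matched sides.\<close>

lemma shared_wall_of_alternating_hexes:
  assumes M: "perfect_matching (HV F) (HE F) M" and "c \<in> F" "c' \<in> F" "fw c c'"
    and "alternating_hex M c" "alternating_hex M c'"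
  shows "wall c c' \<in> M"
proof (rule ccontr)
  assume n: "wall c c' \<notin> M"
  then have "source M c" "sink M c'"
    using assms alternating_hex_iff[OF M] unfolding source_def sink_def by blast+
  moreover obtain r where "tri c c' r" using ex_tri_out[OF assms(4)] .
  ultimately show False
    using one_wall_if_perfect_matching[OF M] assms(2)
    unfolding source_def sink_def one_wall_def tri_def by blast
qed

text \<open>Alternating hexagons have disjoint sets of unmatched edges, which is what makes the
  count in \<open>fr_le_card\<close> injective.\<close>

lemma unmatched_edge_of_alternating_hex:
  assumes M: "perfect_matching (HV F) (HE F) M" and "c \<in> F" "c' \<in> F"
    and "alternating_hex M c" "alternating_hex M c'" "e \<in> hexedges c" "e \<in> hexedges c'" "e \<notin> M"
  shows "c = c'"
proof (rule ccontr)
  assume "c \<noteq> c'"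
  obtain p q where "fw p q" "e = wall p q" "c = p \<or> c = q"
    using assms(6) unfolding hexedges_fw by blast
  moreover obtain p' q' where "fw p' q'" "e = wall p' q'" "c' = p' \<or> c' = q'"
    using assms(7) unfolding hexedges_fw by blast
  ultimately have "(fw c c' \<and> e = wall c c') \<or> (fw c' c \<and> e = wall c' c)"
    using wall_inj[of p q p' q'] \<open>c \<noteq> c'\<close> by blast
  then show False using shared_wall_of_alternating_hexes[OF M] assms(2-5,8) by blast
qed

lemma pred_closed_source: "source M c \<Longrightarrow> pred_closed M {c}"
  unfolding source_def pred_closed_def by blast

lemma anti_forcing_set_hits_source:
  assumes "anti_forcing_set F M S" "c \<in> F" "source M c"
  shows "S \<inter> hexedges c \<noteq> {}"
proof -
  obtain p q where "fw p q" "p \<in> {c}" "wall p q \<in> S"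
    using anti_forcing_set_hits[OF assms(1) _ _ _ pred_closed_source[OF assms(3)]] assms(2)
    by blast
  then show ?thesis unfolding hexedges_fw by blast
qed

text \<open>The matching of a triphenylene in which the perimeter and the central hexagon alternate, but none
  of the three outer hexagons.\<close>

definition isolated_source :: "hcentre set \<Rightarrow> hvert set set \<Rightarrow> hcentre \<Rightarrow> bool" where
  "isolated_source F M s \<longleftrightarrow> s \<in> F \<and> source M s \<and>
     (\<forall>t. fw s t \<longrightarrow> t \<in> F \<and> (\<forall>q. fw q t \<and> q \<noteq> s \<longrightarrow> wall q t \<in> M))"

text \<open>The four hexagons form a predecessor-closed set, so \<open>S\<close> contains a wall
  leaving it, from some outer hexagon \<open>x\<close> to some \<open>z\<close>. An alternating
  hexagon on this unmatched wall would be \<open>x\<close> as a source, impossible because of the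
  arc from \<open>s\<close>, or \<open>z\<close> as a sink.\<close>

lemma isolated_source_extra_wall:
  assumes M: "perfect_matching (HV F) (HE F) M" and S: "anti_forcing_set F M S"
    and s: "isolated_source F M s"
  obtains e where "e \<in> S" "\<And>c. c \<in> F \<Longrightarrow> alternating_hex M c \<Longrightarrow> e \<notin> hexedges c"
proof -
  define U where "U = insert s {t. fw s t}"
  have sF: "s \<in> F" and src: "source M s" and t: "\<And>t. fw s t \<Longrightarrow> t \<in> F"
    and only: "\<And>t q. fw s t \<Longrightarrow> fw q t \<Longrightarrow> q \<noteq> s \<Longrightarrow> wall q t \<in> M"
    using s unfolding isolated_source_def by blast+
  have "finite U" "U \<noteq> {}" "U \<subseteq> F" using finite_out sF t unfolding U_def by auto
  moreover have "pred_closed M U"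
    using src only unfolding pred_closed_def source_def U_def by blast
  ultimately obtain x z where xz: "fw x z" "x \<in> U" "z \<notin> U" "wall x z \<in> S"
    using anti_forcing_set_hits[OF S] by blast
  then have x: "fw s x" unfolding U_def by blast
  have notM: "wall x z \<notin> M" using xz(4) S unfolding anti_forcing_set_def by blast
  have "wall x z \<notin> hexedges c" if c: "c \<in> F" "alternating_hex M c" for c
  proof
    assume "wall x z \<in> hexedges c"
    then obtain p q where "fw p q" "wall x z = wall p q" "c = p \<or> c = q"
      unfolding hexedges_fw by blast
    then consider "c = x" | "c = z" using wall_inj xz(1) by blast
    then show False
    proof cases
      case 1
      then have "source M x" using c notM xz(1) alternating_hex_iff[OF M] unfolding sink_def by blast
      then show False using source_out[OF M sF src x] x unfolding source_def by blast
    next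
      case 2
      then have sink: "sink M z"
        using c notM xz(1) alternating_hex_iff[OF M] unfolding source_def by blast
      \<comment> \<open>If \<open>z\<close> is a sink, the third corner of either triangle on this
        wall has an unmatched wall to \<open>x\<close>, so it is \<open>s\<close>. But the two
        triangles have different third corners.\<close>
      obtain w w' where w: "tri x z w" "tri x z w'" "w \<noteq> w'" using ex_tri_out[OF xz(1)] .
      have "w'' = s" if "tri x z w''" for w''
      proof (rule ccontr)
        assume "w'' \<noteq> s"
        then have "wall w'' x \<in> M" using only x that unfolding tri_def by blast
        then show False
          using sink that one_wall_if_perfect_matching[OF M that] t x
          unfolding sink_def tri_def one_wall_def by blast
      qed
      then show False using w by blast
    qed
  qed
  then show thesis using that xz(4) by blast
qed

end

section \<open>The lower bound \<open>fr\<close> for anti-forcing sets\<close>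

lemma backward_source: "backward.source M c \<longleftrightarrow> forward.sink M c"
  unfolding backward.source_def forward.sink_def by (simp add: wall_commute)

lemma anti_forcing_set_hits_alternating_hex:
  assumes "perfect_matching (HV F) (HE F) M" "anti_forcing_set F M S" "c \<in> F" "alternating_hex M c"
  shows "S \<inter> hexedges c \<noteq> {}"
  using assms forward.alternating_hex_iff[OF assms(1,3)] backward_source
    forward.anti_forcing_set_hits_source backward.anti_forcing_set_hits_source by blast

text \<open>Each alternating hexagon selects one of its edges in \<open>S\<close>, and no edge is
  selected twice. The set \<open>T\<close> allows an edge that lies on no alternating hexagon to be
  left out, which gives the strict inequality.\<close>

lemma fr_le_card:
  assumes F: "finite F" and M: "perfect_matching (HV F) (HE F) M" and S: "anti_forcing_set F M S"
    and T: "T \<subseteq> S" "\<And>c e. c \<in> F \<Longrightarrow> alternating_hex M c \<Longrightarrow> e \<in> S \<Longrightarrow> e \<in> hexedges c \<Longrightarrow> e \<in> T"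
  shows "fr F M \<le> card T"
proof -
  define A where "A = {c \<in> F. alternating_hex M c}"
  have "\<forall>c\<in>A. \<exists>e. e \<in> S \<inter> hexedges c"
    using anti_forcing_set_hits_alternating_hex[OF M S] unfolding A_def by blast
  then obtain f where f: "\<And>c. c \<in> A \<Longrightarrow> f c \<in> S \<inter> hexedges c" by metis
  have SM: "S \<subseteq> HE F - M" using S unfolding anti_forcing_set_def by blast
  have "inj_on f A"
  proof (rule inj_onI)
    fix c c' assume "c \<in> A" "c' \<in> A" "f c = f c'"
    then show "c = c'"
      using f[of c] f[of c'] SM forward.unmatched_edge_of_alternating_hex[OF M, of c c' "f c"]
      unfolding A_def by auto
  qed
  moreover have "f ` A \<subseteq> T" using f T(2) unfolding A_def by blast
  moreover have "finite T" using finite_HE[OF F] SM T(1) by (meson Diff_subset finite_subset)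
  ultimately show ?thesis
    unfolding fr_def A_def[symmetric] by (rule card_inj_on_le)
qed

lemma fr_less_card_if_extra_wall:
  assumes F: "finite F" and M: "perfect_matching (HV F) (HE F) M" and S: "anti_forcing_set F M S"
    and e: "e \<in> S" "\<And>c. c \<in> F \<Longrightarrow> alternating_hex M c \<Longrightarrow> e \<notin> hexedges c"
  shows "fr F M < card S"
proof -
  have "fr F M \<le> card (S - {e})"
    using e(2) by (intro fr_le_card[OF F M S]) auto
  moreover have "finite S"
    using finite_HE[OF F] S unfolding anti_forcing_set_def by (meson Diff_subset finite_subset)
  ultimately show ?thesis
    using card_Diff1_less[of S e] e(1) by linarith
qed

subsection \<open>Stuck sets and the greedy choice\<close>

lemma ex_height:
  assumes "hexsys F" "perfect_matching (HV F) (HE F) M"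
  obtains \<phi> :: "hcentre \<Rightarrow> int" where
    "\<And>p q. p \<in> F \<Longrightarrow> q \<in> F \<Longrightarrow> fwd p q \<Longrightarrow> wall p q \<notin> M \<Longrightarrow> \<phi> q = \<phi> p + 1"
proof -
  have F: "finite F" "hex_connected (- F)" using assms(1) unfolding hexsys_def by blast+
  \<comment> \<open>Each triangle has one matched and two unmatched sides, so its values sum to -2 +
    1 + 1 = 0.\<close>
  define g where "g p q = (if wall p q \<in> M then - 2 else 1 :: int)" for p q
  have "g p q + g q r + g r p = 0" if "p \<in> F" "fwd p q" "fwd q r" "fwd r p" for p q r
    using forward.one_wall_if_perfect_matching[OF assms(2), of p q r] that
    unfolding forward.tri_def forward.one_wall_def g_def by auto
  then obtain \<phi> where "\<And>p q. p \<in> F \<Longrightarrow> q \<in> F \<Longrightarrow> fwd p q \<Longrightarrow> \<phi> q - \<phi> p = g p q"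
    using closed_form_extends[OF F, of g] by blast
  then show thesis using that[of \<phi>] unfolding g_def by fastforce
qed

context orientation
begin

lemma ex_height_fw:
  assumes "hexsys F" "perfect_matching (HV F) (HE F) M"
  obtains \<phi> :: "hcentre \<Rightarrow> int" where
    "\<And>p q. p \<in> F \<Longrightarrow> q \<in> F \<Longrightarrow> fw p q \<Longrightarrow> wall p q \<notin> M \<Longrightarrow> \<phi> q = \<phi> p + 1"
proof -
  obtain \<phi> where \<phi>: "\<And>p q. p \<in> F \<Longrightarrow> q \<in> F \<Longrightarrow> fwd p q \<Longrightarrow> wall p q \<notin> M \<Longrightarrow> \<phi> q = \<phi> p + (1 :: int)"
    using ex_height[OF assms] by blast
  show thesis
    using fw_cases
  proof
    assume "fw = fwd"
    then show thesis using that[of \<phi>] \<phi> by simp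
  next
    assume fw: "fw = (\<lambda>p q. fwd q p)"
    show thesis
    proof (rule that[of "\<lambda>p. - \<phi> p"])
      fix p q assume "p \<in> F" "q \<in> F" "fw p q" "wall p q \<notin> M"
      then show "- \<phi> q = - \<phi> p + 1"
        using \<phi>[of q p] fw by (simp add: wall_commute[of q p])
    qed
  qed
qed

section \<open>The digraph of unmatched walls and its stuck sets\<close>

definition arc :: "hvert set set \<Rightarrow> hcentre \<Rightarrow> hcentre \<Rightarrow> bool" where
  "arc M p q \<longleftrightarrow> fw p q \<and> wall p q \<notin> M"

lemma source_iff_no_arc: "source M p \<longleftrightarrow> (\<forall>q. \<not> arc M q p)"
  unfolding source_def arc_def by blast

lemma pred_closed_arc: "pred_closed M U \<longleftrightarrow> (\<forall>p q. arc M p q \<and> q \<in> U \<longrightarrow> p \<in> U)"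
  unfolding pred_closed_def arc_def by blast

text \<open>No arc enters such a set, and reversing an arc at one of its sources does not create an
  entry either. This is the obstruction to the greedy choice of walls.\<close>

definition stuck :: "hcentre set \<Rightarrow> hvert set set \<Rightarrow> hcentre set \<Rightarrow> bool" where
  "stuck F M U \<longleftrightarrow> U \<noteq> {} \<and> U \<subseteq> F \<and> pred_closed M U \<and>
     (\<forall>p\<in>U. source M p \<longrightarrow> (\<forall>q. fw p q \<longrightarrow> q \<in> U))"

text \<open>A predecessor would also lie in \<open>U\<close>, one level lower.\<close>

lemma lowest_is_source:
  assumes "pred_closed M U" "p \<in> U" "\<And>q. q \<in> U \<Longrightarrow> \<phi> p \<le> (\<phi> q :: int)"
    and "\<And>p q. p \<in> U \<Longrightarrow> q \<in> U \<Longrightarrow> arc M p q \<Longrightarrow> \<phi> q = \<phi> p + 1"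
  shows "source M p"
  unfolding source_iff_no_arc
proof (intro allI notI)
  fix q assume q: "arc M q p"
  then have "q \<in> U" using assms(1,2) unfolding pred_closed_arc by blast
  then show False using assms(3)[of q] assms(4)[of q p] q assms(2) by simp
qed

text \<open>Every lowest hexagon of \<open>U\<close> is a source, so \<open>s\<close> is the only
  lowest one. Another predecessor of an out-neighbour of \<open>s\<close> would have the same height
  as \<open>s\<close> and hence be \<open>s\<close> itself.\<close>

lemma unique_source_isolated:
  assumes F: "hexsys F" and M: "perfect_matching (HV F) (HE F) M" and U: "stuck F M U"
    and s: "\<And>p. p \<in> U \<Longrightarrow> source M p \<Longrightarrow> p = s"
  shows "isolated_source F M s"
proof -
  have UF: "U \<subseteq> F" and U0: "U \<noteq> {}" and pred: "pred_closed M U"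
    and out: "\<And>p q. p \<in> U \<Longrightarrow> source M p \<Longrightarrow> fw p q \<Longrightarrow> q \<in> U"
    using U unfolding stuck_def by blast+
  have "finite F" using F unfolding hexsys_def by blast
  then have fin: "finite U" using UF finite_subset by blast
  obtain \<phi> where *: "\<And>p q. p \<in> F \<Longrightarrow> q \<in> F \<Longrightarrow> fw p q \<Longrightarrow> wall p q \<notin> M \<Longrightarrow> \<phi> q = \<phi> p + (1 :: int)"
    using ex_height_fw[OF F M] by blast
  have \<phi>: "\<phi> q = \<phi> p + 1" if "p \<in> U" "q \<in> U" "arc M p q" for p q
    using * that UF unfolding arc_def by blast
  have lowest: "p = s" if p: "p \<in> U" "\<And>q. q \<in> U \<Longrightarrow> \<phi> p \<le> \<phi> q" for p
    using lowest_is_source[where \<phi> = \<phi>, OF pred p \<phi>] s[OF p(1)] by blast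
  obtain m where m: "m \<in> U" "\<And>q. q \<in> U \<Longrightarrow> \<phi> m \<le> \<phi> q"
  proof -
    have img: "finite (\<phi> ` U)" "\<phi> ` U \<noteq> {}" using fin U0 by auto
    obtain m where "Min (\<phi> ` U) = \<phi> m" "m \<in> U" using Min_in[OF img] by (rule imageE)
    then show thesis using that[of m] Min_le[OF img(1)] by (metis imageI)
  qed
  have ms: "m = s" using lowest m by blast
  have src: "source M s" using lowest_is_source[where \<phi> = \<phi>, OF pred m \<phi>] ms by blast
  have sU: "s \<in> U" using m(1) ms by blast
  show ?thesis
    unfolding isolated_source_def
  proof (intro conjI allI impI)
    show "s \<in> F" using sU UF by blast
    show "source M s" by (rule src)
  next
    fix t assume t: "fw s t"
    then have tU: "t \<in> U" using out[OF sU src] by blast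
    then show "t \<in> F" using UF by blast
    fix q assume q: "fw q t \<and> q \<noteq> s"
    show "wall q t \<in> M"
    proof (rule ccontr)
      assume "wall q t \<notin> M"
      then have qt: "arc M q t" using q unfolding arc_def by blast
      then have qU: "q \<in> U" using pred tU unfolding pred_closed_arc by blast
      have "arc M s t" using source_out[OF M _ src t] sU UF t unfolding arc_def by blast
      then have "\<phi> q = \<phi> s" using \<phi>[OF sU tU] \<phi>[OF qU tU qt] by simp
      then have "q = s" using lowest[OF qU] m ms by simp
      then show False using q by blast
    qed
  qed
qed

text \<open>Induction on the number of sources in \<open>U\<close>; the case of a single source is
  \<open>unique_source_isolated\<close>. Otherwise the highest source is rotated and the smaller set
  \<open>U'\<close> is stuck for the new matching.\<close>

lemma stuck_imp_isolated_source:
  assumes F: "hexsys F"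
  shows "perfect_matching (HV F) (HE F) M \<Longrightarrow> stuck F M U \<Longrightarrow>
    \<exists>M' s. perfect_matching (HV F) (HE F) M' \<and> isolated_source F M' s"
proof (induction "card {p \<in> U. source M p}" arbitrary: M U rule: less_induct)
  case less
  note M = less.prems(1)
  have UF: "U \<subseteq> F" and U0: "U \<noteq> {}" and pred: "pred_closed M U"
    and out: "\<And>p q. p \<in> U \<Longrightarrow> source M p \<Longrightarrow> fw p q \<Longrightarrow> q \<in> U"
    using less.prems(2) unfolding stuck_def by blast+
  have "finite F" using F unfolding hexsys_def by blast
  then have fin: "finite U" using UF finite_subset by blast
  obtain \<phi> where *: "\<And>p q. p \<in> F \<Longrightarrow> q \<in> F \<Longrightarrow> fw p q \<Longrightarrow> wall p q \<notin> M \<Longrightarrow> \<phi> q = \<phi> p + (1 :: int)"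
    using ex_height_fw[OF F M] by blast
  have \<phi>: "\<phi> q = \<phi> p + 1" if "p \<in> U" "q \<in> U" "arc M p q" for p q
    using * that UF unfolding arc_def by blast
  let ?A = "{p \<in> U. source M p}"
  show ?case
  proof (cases "\<exists>s. \<forall>p\<in>U. source M p \<longrightarrow> p = s")
    case True
    then obtain s where "\<And>p. p \<in> U \<Longrightarrow> source M p \<Longrightarrow> p = s" by blast
    then show ?thesis using unique_source_isolated[OF F M less.prems(2)] M by blast
  next
    case False
    then have A0: "?A \<noteq> {}" by blast
    have "finite ?A" using fin by simp
    then obtain s where s: "s \<in> ?A" "\<And>p. p \<in> ?A \<Longrightarrow> \<phi> p \<le> \<phi> s"
    proof -
      have img: "finite (\<phi> ` ?A)" "\<phi> ` ?A \<noteq> {}" using \<open>finite ?A\<close> A0 by blast+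
      obtain m where m: "Max (\<phi> ` ?A) = \<phi> m" "m \<in> ?A" using Max_in[OF img] by (rule imageE)
      have "\<phi> p \<le> \<phi> m" if "p \<in> ?A" for p
        unfolding m(1)[symmetric] using imageI[OF that] by (rule Max_ge[OF img(1)])
      then show thesis using m(2) by (rule that[rotated])
    qed
    then have sU: "s \<in> U" and src: "source M s" by auto
    have sF: "s \<in> F" using sU UF by blast
    obtain s' where s': "s' \<in> ?A" "s' \<noteq> s" using False by blast
    \<comment> \<open>The rotation turns \<open>s\<close> from a source into a sink and changes the
      status of walls at \<open>s\<close> only.\<close>
    define M' where "M' = flip M {s}"
    have M': "perfect_matching (HV F) (HE F) M'"
      unfolding M'_def using perfect_matching_flip[OF M _ pred_closed_source[OF src]] sF by blast
    have wall_M': "wall p q \<in> M' \<longleftrightarrow> wall p q \<in> M" if "fw p q" "p \<noteq> s" "q \<noteq> s" for p q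
      unfolding M'_def using wall_in_flip[OF that(1)] that(2,3) by simp
    have wall_s: "wall s q \<in> M'" if "fw s q" for q
      unfolding M'_def using wall_in_flip[OF that, of M "{s}"] that fw_irrefl[of s]
      by (cases "q = s") simp_all
    have no_arc: "\<not> arc M p s" for p
      using src unfolding source_iff_no_arc by blast
    have arc_s: "arc M s q" if "fw s q" for q
      using source_out[OF M sF src that] that unfolding arc_def by blast
    text \<open>\<open>New\<close> consists of the hexagons that become sources; by maximality of the height of \<open>s\<close>, no hexagon
      reachable from them is an out-neighbour of a remaining source.\<close>
    define New where "New = {r. fw s r \<and> (\<forall>q. arc M q r \<longrightarrow> q = s)}"
    define R where "R = {(p, q). p \<in> U \<and> q \<in> U \<and> arc M p q}"
    define Up where "Up = {q. \<exists>r\<in>New. (r, q) \<in> R\<^sup>*}"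
    define U' where "U' = U - {s} - Up"
    have NewU: "r \<in> U" if "r \<in> New" for r
      using out[OF sU src] that unfolding New_def by blast
    have above: "q = r \<or> \<phi> r < \<phi> q" if "(r, q) \<in> R\<^sup>*" for r q
      using that
    proof (induction rule: rtrancl_induct)
      case (step y z)
      then have "\<phi> z = \<phi> y + 1" using \<phi> unfolding R_def by blast
      then show ?case using step.IH by auto
    qed simp
    \<comment> \<open>\<open>Up\<close> is closed under arcs within \<open>U\<close>, so no arc
      leads from it to the rest; arcs out of \<open>s\<close> are gone because their walls are now
      matched.\<close>
    have pred': "pred_closed M' U'"
      unfolding pred_closed_def
    proof (intro allI impI)
      fix q p assume qp: "fw q p \<and> p \<in> U' \<and> q \<notin> U'"
      show "wall q p \<in> M'"
      proof (rule ccontr)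
        assume n: "wall q p \<notin> M'"
        have "q \<noteq> s" using wall_s n qp by blast
        moreover have "p \<noteq> s" "p \<in> U" "p \<notin> Up" using qp unfolding U'_def by blast+
        ultimately have qp': "arc M q p" using wall_M' n qp unfolding arc_def by blast
        then have "q \<in> U" using pred \<open>p \<in> U\<close> unfolding pred_closed_arc by blast
        then have "q \<in> Up" using qp \<open>q \<noteq> s\<close> unfolding U'_def by blast
        then obtain r where "r \<in> New" "(r, q) \<in> R\<^sup>*" unfolding Up_def by blast
        moreover have "(q, p) \<in> R" using qp' \<open>q \<in> U\<close> \<open>p \<in> U\<close> unfolding R_def by blast
        ultimately have "p \<in> Up" unfolding Up_def by (blast intro: rtrancl_into_rtrancl)
        then show False using \<open>p \<notin> Up\<close> by blast
      qed
    qed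
    \<comment> \<open>A hexagon that only now becomes a source had \<open>s\<close> as its sole
      predecessor, so it belongs to \<open>New\<close> and has been discarded.\<close>
    have old: "source M p" if p: "p \<in> U'" "source M' p" for p
    proof (rule ccontr)
      assume "\<not> source M p"
      then obtain q where q: "arc M q p" unfolding source_iff_no_arc by blast
      have "q' = s" if q': "arc M q' p" for q'
      proof (rule ccontr)
        assume "q' \<noteq> s"
        then have "wall q' p \<in> M' \<longleftrightarrow> wall q' p \<in> M"
          using wall_M' p(1) q' unfolding U'_def arc_def by blast
        then show False using q' p(2) unfolding source_def arc_def by blast
      qed
      then have "p \<in> New" using q unfolding New_def arc_def by blast
      then have "p \<in> Up" unfolding Up_def by blast
      then show False using p(1) unfolding U'_def by blast
    qed
    \<comment> \<open>Members of \<open>New\<close> have height \<phi> s + 1 and everything else in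
      \<open>Up\<close> is strictly higher, whereas \<open>q\<close> has height \<phi> p + 1, at
      most \<phi> s + 1. Nor is \<open>q\<close> in \<open>New\<close>, as it has the predecessor
      \<open>p\<close>, distinct from \<open>s\<close>.\<close>
    have not_Up: "q \<notin> Up" if p: "p \<in> U" "source M p" "p \<noteq> s" and q: "fw p q" for p q
    proof
      assume "q \<in> Up"
      then obtain r where r: "r \<in> New" "(r, q) \<in> R\<^sup>*" unfolding Up_def by blast
      have pq: "arc M p q" using source_out[OF M _ p(2) q] p(1) UF q unfolding arc_def by blast
      then have "q \<noteq> r" using r(1) p(3) unfolding New_def by blast
      then have "\<phi> r < \<phi> q" using above[OF r(2)] by blast
      moreover have "\<phi> r = \<phi> s + 1"
        using \<phi>[OF sU NewU[OF r(1)]] arc_s r(1) unfolding New_def by blast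
      moreover have "\<phi> q = \<phi> p + 1" using \<phi>[OF p(1) out[OF p(1,2) q] pq] .
      moreover have "\<phi> p \<le> \<phi> s" using s(2)[of p] p(1,2) by blast
      ultimately show False by simp
    qed
    \<comment> \<open>A source is not the end of an arc, so it is neither in \<open>New\<close> nor
      reachable from there; the second source keeps \<open>U'\<close> nonempty.\<close>
    have s'_in: "s' \<in> U'"
    proof -
      have "s' \<notin> Up"
      proof
        assume "s' \<in> Up"
        then obtain r where r: "r \<in> New" "(r, s') \<in> R\<^sup>*" unfolding Up_def by blast
        have src': "source M s'" using s'(1) by blast
        from r(2) show False
        proof (cases rule: rtranclE)
          case base
          then show False using r(1) arc_s src' unfolding New_def source_iff_no_arc by blast
        next
          case (step y)
          then show False using src' unfolding R_def source_iff_no_arc by blast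
        qed
      qed
      then show ?thesis using s' unfolding U'_def by blast
    qed
    have "stuck F M' U'"
      unfolding stuck_def
    proof (intro conjI ballI impI allI)
      show "U' \<noteq> {}" using s'_in by blast
      show "U' \<subseteq> F" using UF unfolding U'_def by blast
      show "pred_closed M' U'" by (rule pred')
    next
      fix p q assume p: "p \<in> U'" "source M' p" and q: "fw p q"
      then have p': "p \<in> U" "source M p" "p \<noteq> s" using old unfolding U'_def by blast+
      moreover have "q \<noteq> s"
        using no_arc[of p] source_out[OF M _ p'(2) q] p'(1) UF q unfolding arc_def by blast
      ultimately show "q \<in> U'" using out[OF p'(1,2) q] not_Up q unfolding U'_def by blast
    qed
    moreover have "{p \<in> U'. source M' p} \<subset> ?A"
      using old s(1) unfolding U'_def by blast
    then have "card {p \<in> U'. source M' p} < card ?A"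
      using \<open>finite ?A\<close> by (rule psubset_card_mono[rotated])
    ultimately show ?thesis using less.hyps M' by blast
  qed
qed

text \<open>One wall is chosen for every source, in the order in which hexagons become reachable from
  outside \<open>U\<close>.\<close>

lemma ex_source_walls:
  assumes "finite F" and not_stuck: "\<And>V. \<not> stuck F M V"
  shows "U \<subseteq> F \<Longrightarrow> pred_closed M U \<Longrightarrow>
    \<exists>N. N \<subseteq> {wall p q | p q. p \<in> U \<and> source M p \<and> fw p q} \<and> finite N \<and>
      card N \<le> card {p \<in> U. source M p} \<and>
      (\<forall>\<psi> :: hcentre \<Rightarrow> int. (\<forall>p q. arc M p q \<longrightarrow> \<psi> p \<le> \<psi> q) \<and> (\<forall>p q. fw p q \<and> wall p q \<in> N \<longrightarrow> \<psi> p = \<psi> q) \<and>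
         (\<forall>p. p \<notin> U \<longrightarrow> 0 \<le> \<psi> p) \<longrightarrow> (\<forall>p. 0 \<le> \<psi> p))"
proof (induction "card U" arbitrary: U rule: less_induct)
  case less
  have fin: "finite U" using assms(1) less.prems(1) finite_subset by blast
  show ?case
  proof (cases "U = {}")
    case True
    then show ?thesis by (intro exI[of _ "{}"]) simp
  next
    case False
    \<comment> \<open>As \<open>U\<close> is not stuck, some source has an out-neighbour outside
      \<open>U\<close>; \<open>wall s t\<close> is the wall chosen for \<open>s\<close>.\<close>
    then obtain s t where s: "s \<in> U" "source M s" "fw s t" "t \<notin> U"
      using not_stuck[of U] less.prems unfolding stuck_def by blast
    define Up where "Up = {q. (s, q) \<in> {(p, q). arc M p q}\<^sup>*}"
    define U' where "U' = U - Up"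
    have sUp: "s \<in> Up" unfolding Up_def by blast
    have sub: "U' \<subset> U" using s(1) sUp unfolding U'_def by blast
    have "p \<in> U'" if pq: "arc M p q" "q \<in> U'" for p q
    proof -
      have "p \<in> U" using less.prems(2) pq unfolding pred_closed_arc U'_def by blast
      moreover have "p \<notin> Up"
      proof
        assume "p \<in> Up"
        then have "q \<in> Up" using pq(1) unfolding Up_def by (auto intro: rtrancl_into_rtrancl)
        then show False using pq(2) unfolding U'_def by blast
      qed
      ultimately show ?thesis unfolding U'_def by blast
    qed
    then have pred: "pred_closed M U'" unfolding pred_closed_arc by blast
    have "U' \<subseteq> F" using sub less.prems(1) by blast
    from less.hyps[OF psubset_card_mono[OF fin sub] this pred]
    obtain N where N_all: "N \<subseteq> {wall p q | p q. p \<in> U' \<and> source M p \<and> fw p q} \<and> finite N \<and>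
      card N \<le> card {p \<in> U'. source M p} \<and>
      (\<forall>\<psi> :: hcentre \<Rightarrow> int. (\<forall>p q. arc M p q \<longrightarrow> \<psi> p \<le> \<psi> q) \<and> (\<forall>p q. fw p q \<and> wall p q \<in> N \<longrightarrow> \<psi> p = \<psi> q) \<and>
         (\<forall>p. p \<notin> U' \<longrightarrow> 0 \<le> \<psi> p) \<longrightarrow> (\<forall>p. 0 \<le> \<psi> p))"
      by (rule exE)
    note N = N_all[THEN conjunct1] N_all[THEN conjunct2, THEN conjunct1]
      N_all[THEN conjunct2, THEN conjunct2, THEN conjunct1]
      N_all[THEN conjunct2, THEN conjunct2, THEN conjunct2]
    show ?thesis
    proof (intro exI[of _ "insert (wall s t) N"] conjI allI impI)
      show "insert (wall s t) N \<subseteq> {wall p q | p q. p \<in> U \<and> source M p \<and> fw p q}"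
        using N(1) s sub by blast
      show "finite (insert (wall s t) N)" using N(2) by simp
      have "{p \<in> U'. source M p} \<subset> {p \<in> U. source M p}"
        using s(1,2) sUp unfolding U'_def by blast
      then have "card {p \<in> U'. source M p} < card {p \<in> U. source M p}"
        using fin by (intro psubset_card_mono) auto
      then show "card (insert (wall s t) N) \<le> card {p \<in> U. source M p}"
        using N(2,3) by (simp add: card_insert_if)
    next
      fix \<psi> :: "hcentre \<Rightarrow> int" and p
      assume \<psi>: "(\<forall>p q. arc M p q \<longrightarrow> \<psi> p \<le> \<psi> q) \<and>
        (\<forall>p q. fw p q \<and> wall p q \<in> insert (wall s t) N \<longrightarrow> \<psi> p = \<psi> q) \<and> (\<forall>p. p \<notin> U \<longrightarrow> 0 \<le> \<psi> p)"
      \<comment> \<open>The chosen wall equates the values at its ends and so carries the bound from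
        \<open>t\<close> against the arc to \<open>s\<close>. From there it spreads along arcs over
        \<open>Up\<close>.\<close>
      have s0: "0 \<le> \<psi> s" using \<psi> s(3,4) by (metis insertI1)
      have "0 \<le> \<psi> q" if "q \<in> Up" for q
        using that unfolding Up_def mem_Collect_eq
      proof (induction rule: rtrancl_induct)
        case base
        then show ?case by (rule s0)
      next
        case (step y z)
        then have "\<psi> y \<le> \<psi> z" using \<psi> by blast
        then show ?case using step.IH by simp
      qed
      then have "\<forall>q. q \<notin> U' \<longrightarrow> 0 \<le> \<psi> q"
        using \<psi> unfolding U'_def by blast
      moreover have "\<forall>p q. arc M p q \<longrightarrow> \<psi> p \<le> \<psi> q"
        "\<forall>p q. fw p q \<and> wall p q \<in> N \<longrightarrow> \<psi> p = \<psi> q"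
        using \<psi> by blast+
      ultimately show "0 \<le> \<psi> p"
        using N(4) by blast
    qed
  qed
qed

end

subsection \<open>Anti-forcing sets\<close>

text \<open>Two perfect matchings are compared through the potential of their difference: uniqueness of \<open>M\<close>
  after deleting an anti-forcing set amounts to this potential vanishing everywhere.\<close>

lemma ex_difference_potential:
  assumes F: "hexsys F" and M: "perfect_matching (HV F) (HE F) M"
    and M': "perfect_matching (HV F) (HE F) M'"
  obtains \<psi> :: "hcentre \<Rightarrow> int" where "\<And>p. p \<notin> F \<Longrightarrow> \<psi> p = 0"
    "\<And>p q. fwd p q \<Longrightarrow> \<psi> q - \<psi> p = of_bool (wall p q \<in> M') - of_bool (wall p q \<in> M)"
proof -
  define g where "g p q = (of_bool (wall p q \<in> M') - of_bool (wall p q \<in> M) :: int)" for p q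
  have sub: "M \<subseteq> HE F" "M' \<subseteq> HE F" using M M' unfolding perfect_matching_def by blast+
  have outside: "wall p q \<notin> M \<and> wall p q \<notin> M'" if "fwd p q" "p \<notin> F" "q \<notin> F" for p q
    using sub that forward.wall_in_HE[of p q F] by blast
  \<comment> \<open>Both matchings take exactly one side of each triangle meeting \<open>F\<close>,
    so the differences cancel.\<close>
  have "curl g v = 0" for v
  proof -
    obtain p q r where t: "fwd p q" "fwd q r" "fwd r p" "\<And>g. curl g v = g p q + g q r + g r p"
      using curl_triangle[of v] by metis
    have tri: "forward.tri p q r" using t unfolding forward.tri_def by blast
    show ?thesis
    proof (cases "p \<in> F \<or> q \<in> F \<or> r \<in> F")
      case True
      then have "forward.one_wall M p q r" "forward.one_wall M' p q r"
        using forward.one_wall_if_perfect_matching tri M M' by blast+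
      then show ?thesis unfolding t(4) g_def forward.one_wall_def by auto
    next
      case False
      then show ?thesis using outside t(1-3) unfolding t(4) g_def by simp
    qed
  qed
  then obtain \<phi> where \<phi>: "\<And>p q. fwd p q \<Longrightarrow> \<phi> q - \<phi> p = g p q"
    using curl_free_imp_gradient[of g] by blast
  have conn: "hex_connected (- F)" using F unfolding hexsys_def by blast
  \<comment> \<open>No wall between two hexagons outside \<open>F\<close> is matched, so the
    potential is constant on the connected complement and can be normalised to 0 there.\<close>
  have const: "\<phi> q = \<phi> p" if pq: "p \<notin> F" "q \<notin> F" for p q
  proof (rule hex_connected_induct[OF conn, of p q "\<lambda>x. \<phi> x = \<phi> p"])
    fix s t assume "s \<in> - F" "t \<in> - F" "fwd s t \<or> fwd t s" "\<phi> s = \<phi> p"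
    then show "\<phi> t = \<phi> p"
      using \<phi>[of s t] \<phi>[of t s] outside[of s t] outside[of t s] unfolding g_def by auto
  qed (use pq in auto)
  obtain o' where o': "o' \<notin> F"
    using F forward.ex_leaving_wall[of F] unfolding hexsys_def by blast
  show thesis
  proof (rule that[of "\<lambda>p. \<phi> p - \<phi> o'"])
    show "\<phi> p - \<phi> o' = 0" if "p \<notin> F" for p
      using const[OF o' that] by simp
    show "(\<phi> q - \<phi> o') - (\<phi> p - \<phi> o') = of_bool (wall p q \<in> M') - of_bool (wall p q \<in> M)"
      if "fwd p q" for p q
      using \<phi>[OF that] unfolding g_def by simp
  qed
qed

context orientation
begin

text \<open>In the opposite orientation the potential is \<open>- \<psi>\<close>, so the same property bounds \<open>\<psi>\<close> from above.\<close>

definition forces_nonneg :: "hcentre set \<Rightarrow> hvert set set \<Rightarrow> hvert set set \<Rightarrow> bool" where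
  "forces_nonneg F M N \<longleftrightarrow>
     (\<forall>M' (\<psi> :: hcentre \<Rightarrow> int). M' \<inter> N = {} \<and> (\<forall>p. p \<notin> F \<longrightarrow> \<psi> p = 0) \<and>
       (\<forall>p q. fw p q \<longrightarrow> \<psi> q - \<psi> p = of_bool (wall p q \<in> M') - of_bool (wall p q \<in> M)) \<longrightarrow>
       (\<forall>p. 0 \<le> \<psi> p))"

text \<open>The potential vanishes outside \<open>F\<close> and does not decrease along arcs, so it
  is nonnegative on all hexagons reachable from outside. The greedy walls extend the bound to the
  set \<open>U\<close> of the remaining ones.\<close>

lemma ex_walls_forcing_nonneg:
  assumes F: "hexsys F" and M: "perfect_matching (HV F) (HE F) M" and not_stuck: "\<And>V. \<not> stuck F M V"
  obtains N where "N \<subseteq> HE F - M" "finite N" "card N \<le> card {p \<in> F. source M p}"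
    "forces_nonneg F M N"
proof -
  define U where "U = F - {q. \<exists>p. p \<notin> F \<and> (p, q) \<in> {(p, q). arc M p q}\<^sup>*}"
  have "finite F" using F unfolding hexsys_def by blast
  have UF: "U \<subseteq> F" unfolding U_def by blast
  have "p \<in> U" if pq: "arc M p q" "q \<in> U" for p q
  proof (rule ccontr)
    assume "p \<notin> U"
    then obtain o' where "o' \<notin> F" "(o', p) \<in> {(p, q). arc M p q}\<^sup>*" unfolding U_def by blast
    then have "(o', q) \<in> {(p, q). arc M p q}\<^sup>*" using pq(1) by (auto intro: rtrancl_into_rtrancl)
    then show False using pq(2) \<open>o' \<notin> F\<close> unfolding U_def by blast
  qed
  then have pred: "pred_closed M U" unfolding pred_closed_arc by blast
  from ex_source_walls[OF \<open>finite F\<close> not_stuck UF pred]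
  obtain N where N: "N \<subseteq> {wall p q | p q. p \<in> U \<and> source M p \<and> fw p q} \<and> finite N \<and>
      card N \<le> card {p \<in> U. source M p} \<and>
      (\<forall>\<psi> :: hcentre \<Rightarrow> int. (\<forall>p q. arc M p q \<longrightarrow> \<psi> p \<le> \<psi> q) \<and> (\<forall>p q. fw p q \<and> wall p q \<in> N \<longrightarrow> \<psi> p = \<psi> q) \<and>
         (\<forall>p. p \<notin> U \<longrightarrow> 0 \<le> \<psi> p) \<longrightarrow> (\<forall>p. 0 \<le> \<psi> p))"
    by (rule exE)
  have N1: "wall p q \<notin> M" if pq: "fw p q" "wall p q \<in> N" for p q
  proof -
    obtain s t where "wall p q = wall s t" "s \<in> U" "source M s" "fw s t"
      using N pq(2) by blast
    then show ?thesis using source_out[OF M, of s t] UF by auto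
  qed
  show thesis
  proof (rule that[of N])
    show "N \<subseteq> HE F - M"
    proof
      fix e assume "e \<in> N"
      then obtain s t where "e = wall s t" "s \<in> U" "fw s t" using N by blast
      then show "e \<in> HE F - M" using wall_in_HE[of s t F] N1[of s t] UF \<open>e \<in> N\<close> by blast
    qed
    show "finite N" using N by blast
    have "card {p \<in> U. source M p} \<le> card {p \<in> F. source M p}"
      using UF \<open>finite F\<close> by (intro card_mono) auto
    then show "card N \<le> card {p \<in> F. source M p}" using N by linarith
  next
    show "forces_nonneg F M N"
      unfolding forces_nonneg_def
    proof (intro allI impI, elim conjE)
      fix M' and \<psi> :: "hcentre \<Rightarrow> int" and p
      assume M': "M' \<inter> N = {}" and out: "\<forall>p. p \<notin> F \<longrightarrow> \<psi> p = 0"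
        and \<psi>: "\<forall>p q. fw p q \<longrightarrow> \<psi> q - \<psi> p = of_bool (wall p q \<in> M') - of_bool (wall p q \<in> M)"
      have mono: "\<psi> p \<le> \<psi> q" if "arc M p q" for p q
        using that \<psi>[rule_format, of p q] unfolding arc_def by (cases "wall p q \<in> M'") simp_all
      \<comment> \<open>A wall in \<open>N\<close> belongs to neither matching.\<close>
      have "\<psi> p = \<psi> q" if pq: "fw p q" "wall p q \<in> N" for p q
      proof -
        have "wall p q \<notin> M'" using M' pq(2) by blast
        then show ?thesis using \<psi>[rule_format, OF pq(1)] N1[OF pq] by simp
      qed
      moreover have "0 \<le> \<psi> q" if q: "q \<notin> U" for q
      proof -
        have "\<exists>p. p \<notin> F \<and> (p, q) \<in> {(p, q). arc M p q}\<^sup>*"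
          using q unfolding U_def by blast
        then obtain o' where o': "o' \<notin> F" "(o', q) \<in> {(p, q). arc M p q}\<^sup>*" by blast
        from o'(2) show ?thesis
        proof (induction rule: rtrancl_induct)
          case base
          then show ?case using out[rule_format, OF o'(1)] by simp
        next
          case (step y z)
          then show ?case using mono[of y z] by simp
        qed
      qed
      ultimately show "0 \<le> \<psi> p" using N mono by blast
    qed
  qed
qed

end

text \<open>The walls chosen at sources force \<psi> to be nonnegative, those chosen at sinks force
  it to be nonpositive. Hence it vanishes and the matchings agree. The sizes add up to at most
  \<open>fr\<close> because no hexagon of \<open>F\<close> is both a source and a sink.\<close>

lemma ex_small_anti_forcing_set:
  assumes F: "hexsys F" and M: "perfect_matching (HV F) (HE F) M"
    and fwd_not_stuck: "\<And>V. \<not> forward.stuck F M V" and bwd_not_stuck: "\<And>V. \<not> backward.stuck F M V"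
  obtains S where "anti_forcing_set F M S" "card S \<le> fr F M"
proof -
  have fin: "finite F" using F unfolding hexsys_def by blast
  obtain N1 where N1: "N1 \<subseteq> HE F - M" "finite N1" "card N1 \<le> card {p \<in> F. forward.source M p}"
    "forward.forces_nonneg F M N1"
    using forward.ex_walls_forcing_nonneg[OF F M fwd_not_stuck] by blast
  obtain N2 where N2: "N2 \<subseteq> HE F - M" "finite N2" "card N2 \<le> card {p \<in> F. backward.source M p}"
    "backward.forces_nonneg F M N2"
    using backward.ex_walls_forcing_nonneg[OF F M bwd_not_stuck] by blast
  let ?S = "N1 \<union> N2"
  have "M' = M" if M': "perfect_matching (HV F) (HE F - ?S) M'" for M'
  proof -
    have pm: "perfect_matching (HV F) (HE F) M'" and disj: "M' \<inter> N1 = {}" "M' \<inter> N2 = {}"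
      using M' unfolding perfect_matching_Diff by blast+
    obtain \<psi> :: "hcentre \<Rightarrow> int" where out: "\<And>p. p \<notin> F \<Longrightarrow> \<psi> p = 0"
      and \<psi>: "\<And>p q. fwd p q \<Longrightarrow> \<psi> q - \<psi> p = of_bool (wall p q \<in> M') - of_bool (wall p q \<in> M)"
      using ex_difference_potential[OF F M pm] by blast
    have "0 \<le> \<psi> p" for p using N1(4) disj(1) out \<psi> unfolding forward.forces_nonneg_def by blast
    moreover have "0 \<le> - \<psi> p" for p
    proof -
      have "- \<psi> p = 0" if "p \<notin> F" for p using out[OF that] by simp
      moreover have "- \<psi> q - - \<psi> p = of_bool (wall p q \<in> M') - of_bool (wall p q \<in> M)" if "fwd q p" for p q
        using \<psi>[OF that] by (simp add: wall_commute[of q p])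
      ultimately show ?thesis
        using N2(4)[unfolded backward.forces_nonneg_def, THEN spec, THEN spec, of M' "\<lambda>p. - \<psi> p"]
          disj(2) by blast
    qed
    ultimately have "\<psi> p = 0" for p by (metis antisym neg_0_le_iff_le)
    then have same: "wall p q \<in> M' \<longleftrightarrow> wall p q \<in> M" if "fwd p q" for p q
      using \<psi>[OF that] by (simp split: if_splits add: of_bool_def)
    have "e \<in> M' \<longleftrightarrow> e \<in> M" if "e \<in> HE F" for e
      using that same unfolding forward.HE_fw by blast
    moreover have "M' \<subseteq> HE F" "M \<subseteq> HE F" using pm M unfolding perfect_matching_def by blast+
    ultimately show "M' = M" by (meson subset_iff subset_antisym)
  qed
  moreover have "perfect_matching (HV F) (HE F - ?S) M"
    unfolding perfect_matching_Diff using M N1(1) N2(1) by blast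
  ultimately have "anti_forcing_set F M ?S"
    unfolding anti_forcing_set_def unique_pm_def using N1(1) N2(1) by blast
  moreover have "card ?S \<le> fr F M"
  proof -
    let ?A = "{p \<in> F. forward.source M p}" and ?B = "{p \<in> F. backward.source M p}"
    have disj: "?A \<inter> ?B = {}"
    proof -
      have False if p: "p \<in> F" "forward.source M p" "forward.sink M p" for p
      proof -
        have pq: "fwd p (fst p + 1, snd p)" by (simp add: fwd_def)
        show False using forward.source_out[OF M p(1,2) pq] p(3) pq unfolding forward.sink_def by blast
      qed
      then show ?thesis unfolding backward_source by blast
    qed
    have "card ?S \<le> card N1 + card N2" by (rule card_Un_le)
    also have "\<dots> \<le> card ?A + card ?B" using N1(3) N2(3) by simp
    also have "\<dots> = card (?A \<union> ?B)" using fin disj by (simp add: card_Un_disjoint)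
    also have "?A \<union> ?B = {c \<in> F. alternating_hex M c}"
      using forward.alternating_hex_iff[OF M] unfolding backward_source by blast
    finally show ?thesis unfolding fr_def .
  qed
  ultimately show thesis using that by blast
qed

section \<open>Equality and strict inequality between \<open>af\<close> and
  \<open>fr\<close>\<close>

lemma af_eq_fr_if_not_stuck:
  assumes F: "hexsys F" and M: "perfect_matching (HV F) (HE F) M"
    and "\<And>V. \<not> forward.stuck F M V" "\<And>V. \<not> backward.stuck F M V"
  shows "af F M = fr F M"
proof -
  have fin: "finite F" using F unfolding hexsys_def by blast
  obtain S where S: "anti_forcing_set F M S" "card S \<le> fr F M"
    using ex_small_anti_forcing_set[OF assms] .
  have le: "fr F M \<le> card S'" if "anti_forcing_set F M S'" for S'
    using fr_le_card[OF fin M that subset_refl] by blast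
  show ?thesis
    unfolding af_def
  proof (rule Least_equality)
    show "\<exists>S. anti_forcing_set F M S \<and> card S = fr F M"
      using S le[OF S(1)] by (intro exI[of _ S]) simp
  qed (use le in blast)
qed

text \<open>Anti-forcing sets exist, so the minimum defining \<open>af\<close> is attained.\<close>

lemma anti_forcing_set_all:
  assumes M: "perfect_matching (HV F) (HE F) M"
  shows "anti_forcing_set F M (HE F - M)"
proof -
  have "M' = M" if M': "perfect_matching (HV F) (HE F) M'" "M' \<inter> (HE F - M) = {}" for M'
  proof
    show sub: "M' \<subseteq> M" using M' unfolding perfect_matching_def by blast
    show "M \<subseteq> M'"
    proof
      fix e assume e: "e \<in> M"
      then have "e \<in> HE F" using M unfolding perfect_matching_def by blast
      then obtain p q where "fwd p q" "e = wall p q" "p \<in> F \<or> q \<in> F"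
        unfolding forward.HE_fw by blast
      then obtain v where v: "v \<in> e" "v \<in> HV F"
        using wall_nonempty[of p q] unfolding wall_def HV_def by blast
      then obtain e' where "e' \<in> M'" "v \<in> e'" using M'(1) unfolding perfect_matching_def by blast
      then show "e \<in> M'" using M e v sub unfolding perfect_matching_def by blast
    qed
  qed
  then show ?thesis
    using M unfolding anti_forcing_set_def unique_pm_def perfect_matching_Diff by blast
qed

lemma fr_less_af_if_extra_wall:
  assumes F: "finite F" and M: "perfect_matching (HV F) (HE F) M"
    and extra: "\<And>S. anti_forcing_set F M S \<Longrightarrow>
      \<exists>e\<in>S. \<forall>c\<in>F. alternating_hex M c \<longrightarrow> e \<notin> hexedges c"
  shows "fr F M < af F M"
proof -
  have "\<exists>S. anti_forcing_set F M S \<and> card S = af F M"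
    unfolding af_def
    by (rule LeastI_ex) (use anti_forcing_set_all[OF M] in blast)
  then obtain S where S: "anti_forcing_set F M S" "card S = af F M" by blast
  obtain e where "e \<in> S" "\<And>c. c \<in> F \<Longrightarrow> alternating_hex M c \<Longrightarrow> e \<notin> hexedges c"
    using extra[OF S(1)] by blast
  then show ?thesis using fr_less_card_if_extra_wall[OF F M S(1)] S(2) by simp
qed

lemma (in orientation) fr_less_af_if_isolated_source:
  assumes "finite F" and M: "perfect_matching (HV F) (HE F) M" and s: "isolated_source F M s"
  shows "fr F M < af F M"
proof (rule fr_less_af_if_extra_wall[OF assms(1,2)])
  fix S assume S: "anti_forcing_set F M S"
  obtain e where "e \<in> S" "\<And>c. c \<in> F \<Longrightarrow> alternating_hex M c \<Longrightarrow> e \<notin> hexedges c"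
    using isolated_source_extra_wall[OF M S s] by metis
  then show "\<exists>e\<in>S. \<forall>c\<in>F. alternating_hex M c \<longrightarrow> e \<notin> hexedges c" by blast
qed

subsection \<open>Triphenylenes\<close>

lemma hexedges_Int:
  assumes "fwd p q \<or> fwd q p"
  shows "hexedges p \<inter> hexedges q = {wall p q}"
proof -
  have "p \<noteq> q" using assms fwd_irrefl by blast
  have "e = wall p q" if e: "e \<in> hexedges p" "e \<in> hexedges q" for e
  proof -
    obtain s t where st: "fwd s t" "e = wall s t" "p = s \<or> p = t"
      using e(1) unfolding hexedges_eq by blast
    moreover have "q = s \<or> q = t"
      using e(2) wall_subset_hexverts[OF st(1)] st(2) unfolding hexedges_def by blast
    ultimately show ?thesis using \<open>p \<noteq> q\<close> wall_commute by blast
  qed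
  moreover have "wall p q \<in> hexedges p" "wall p q \<in> hexedges q"
    using assms wall_commute[of p q] unfolding hexedges_eq by blast+
  ultimately show ?thesis by blast
qed

lemma fwd_out_not_adjacent: "fwd h t \<Longrightarrow> fwd h t' \<Longrightarrow> \<not> fwd t t'"
  and fwd_in_not_adjacent: "fwd t h \<Longrightarrow> fwd t' h \<Longrightarrow> \<not> fwd t' t"
  by (cases h; simp add: fwd_out fwd_in; elim disjE; simp add: fwd_out fwd_in)+

section \<open>Isolated sources as centres of nice triphenylenes\<close>

context orientation
begin

lemma out_not_adjacent:
  assumes "fw h t" "fw h t'"
  shows "\<not> fw t t'"
  using fw_cases
proof
  assume "fw = fwd"
  then show ?thesis using assms fwd_out_not_adjacent by blast
next
  assume "fw = (\<lambda>p q. fwd q p)"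
  then show ?thesis using assms fwd_in_not_adjacent by blast
qed

text \<open>Together with \<open>in_unique\<close>: the incoming walls are alternate sides of the
  hexagon and so form a perfect matching of its six vertices.\<close>

lemma in_cover:
  assumes "v \<in> hexverts p"
  obtains q where "fw q p" "v \<in> wall q p"
  using vertex_in_tri[OF assms] assms unfolding tri_def wall_def by blast

lemma in_unique:
  assumes "fw q p" "fw q' p" "v \<in> wall q p" "v \<in> wall q' p"
  shows "q = q'"
proof -
  have v: "v \<in> hexverts p" "v \<in> hexverts q" "v \<in> hexverts q'" using assms(3,4) unfolding wall_def by blast+
  obtain x y where t: "tri p x y" "v \<in> hexverts x" "v \<in> hexverts y" using vertex_in_tri[OF v(1)] .
  have "q \<in> {p, x, y}" "q' \<in> {p, x, y}"
    using tri_hexes[OF t(1) v(1) t(2,3)] v(2,3) by blast+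
  moreover have "q \<noteq> p" "q' \<noteq> p" using assms(1,2) fw_irrefl by blast+
  moreover have "q \<noteq> x" "q' \<noteq> x" using t(1) assms(1,2) fw_asym unfolding tri_def by blast+
  ultimately show ?thesis by blast
qed

lemma out_hexes_disjoint:
  assumes "fw p q" "fw p q'" "q \<noteq> q'"
  shows "hexverts q \<inter> hexverts q' = {}"
proof (rule ccontr)
  assume "hexverts q \<inter> hexverts q' \<noteq> {}"
  then obtain v where v: "v \<in> hexverts q" "v \<in> hexverts q'" by blast
  obtain x y where t: "tri q x y" "v \<in> hexverts x" "v \<in> hexverts y" using vertex_in_tri[OF v(1)] .
  have "q' \<in> {q, x, y}"
    using tri_hexes[OF t(1) v(1) t(2,3)] v(2) by blast
  then have "fw q q' \<or> fw q' q" using assms(3) t(1) unfolding tri_def by blast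
  then show False using out_not_adjacent assms(1,2) by blast
qed

text \<open>The vertex set of the triphenylene with centre \<open>s\<close> whose outer hexagons are
  the out-neighbours of \<open>s\<close>.\<close>

definition fan_verts :: "hcentre \<Rightarrow> hvert set" where
  "fan_verts s = hexverts s \<union> (\<Union>t\<in>{t. fw s t}. hexverts t)"

text \<open>The matched walls into \<open>s\<close>, and into the outer hexagons from elsewhere,
  stay inside the triphenylene and cover all its vertices. The rest of \<open>M\<close> therefore
  matches the remaining vertices.\<close>

lemma isolated_source_nice:
  assumes M: "perfect_matching (HV F) (HE F) M" and s: "isolated_source F M s"
  shows "has_pm (HV F - fan_verts s) {e \<in> HE F. e \<inter> fan_verts s = {}}"
proof -
  have src: "source M s" and t: "\<And>t. fw s t \<Longrightarrow> t \<in> F" and sF: "s \<in> F"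
    and only: "\<And>t q. fw s t \<Longrightarrow> fw q t \<Longrightarrow> q \<noteq> s \<Longrightarrow> wall q t \<in> M"
    using s unfolding isolated_source_def by blast+
  define M0 where "M0 = {e \<in> M. e \<inter> fan_verts s = {}}"
  have cover_s: "\<exists>e\<in>M. x \<in> e \<and> e \<subseteq> fan_verts s" if x: "x \<in> hexverts s" for x
  proof -
    obtain q where q: "fw q s" "x \<in> wall q s" using in_cover[OF x] .
    moreover have "wall q s \<in> M" using q(1) src unfolding source_def by blast
    moreover have "wall q s \<subseteq> fan_verts s" unfolding wall_def fan_verts_def by blast
    ultimately show ?thesis by blast
  qed
  have cover: "\<exists>e\<in>M. x \<in> e \<and> e \<subseteq> fan_verts s" if x: "x \<in> fan_verts s" for x
  proof (cases "x \<in> hexverts s")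
    case False
    then obtain u where u: "fw s u" "x \<in> hexverts u" using x unfolding fan_verts_def by blast
    obtain q where q: "fw q u" "x \<in> wall q u" using in_cover[OF u(2)] .
    have "q \<noteq> s" using q(2) False unfolding wall_def by blast
    have "wall q u \<in> M" using \<open>q \<noteq> s\<close> only u(1) q(1) by blast
    moreover have "wall q u \<subseteq> fan_verts s" using u(1) unfolding wall_def fan_verts_def by blast
    ultimately show ?thesis using q(2) by blast
  qed (use cover_s in blast)
  have fanF: "fan_verts s \<subseteq> HV F" unfolding fan_verts_def HV_def using sF t by blast
  have uniq: "e = e'" if "e \<in> M" "e' \<in> M" "v \<in> e" "v \<in> e'" "v \<in> HV F" for e e' v
    using M that unfolding perfect_matching_def by blast
  have "perfect_matching (HV F - fan_verts s) {e \<in> HE F. e \<inter> fan_verts s = {}} M0"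
    unfolding perfect_matching_def
  proof (intro conjI ballI)
    show "M0 \<subseteq> {e \<in> HE F. e \<inter> fan_verts s = {}}"
      using M unfolding M0_def perfect_matching_def by blast
    fix v assume v: "v \<in> HV F - fan_verts s"
    then obtain e where e: "e \<in> M" "v \<in> e" using M unfolding perfect_matching_def by blast
    have "e \<inter> fan_verts s = {}"
    proof (rule ccontr)
      assume "e \<inter> fan_verts s \<noteq> {}"
      then obtain x where x: "x \<in> e" "x \<in> fan_verts s" by blast
      obtain e' where "e' \<in> M" "x \<in> e'" "e' \<subseteq> fan_verts s" using cover[OF x(2)] by blast
      then show False using uniq[of e e' x] e x fanF v by blast
    qed
    then have "e \<in> M0" using e unfolding M0_def by blast
    then show "\<exists>!e. e \<in> M0 \<and> v \<in> e"
      using e(2) uniq v unfolding M0_def by blast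
  qed
  then show ?thesis unfolding has_pm_def by blast
qed

lemma nice_imp_isolated_source:
  assumes sF: "s \<in> F" and t: "\<And>t. fw s t \<Longrightarrow> t \<in> F"
    and pm: "has_pm (HV F - fan_verts s) {e \<in> HE F. e \<inter> fan_verts s = {}}"
  obtains M where "perfect_matching (HV F) (HE F) M" "isolated_source F M s"
proof -
  obtain M0 where "perfect_matching (HV F - fan_verts s) {e \<in> HE F. e \<inter> fan_verts s = {}} M0"
    using pm unfolding has_pm_def by blast
  then have pm0: "M0 \<subseteq> {e \<in> HE F. e \<inter> fan_verts s = {}}"
    "\<forall>v\<in>HV F - fan_verts s. \<exists>!e. e \<in> M0 \<and> v \<in> e"
    unfolding perfect_matching_def by (rule conjunct1, rule conjunct2)
  have M0: "e \<in> HE F \<and> e \<inter> fan_verts s = {}" if "e \<in> M0" for e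
    using pm0(1) that by blast
  have M0_ex1: "\<exists>!e. e \<in> M0 \<and> v \<in> e" if "v \<in> HV F" "v \<notin> fan_verts s" for v
    by (rule pm0(2)[rule_format, OF DiffI[OF that]])
  \<comment> \<open>A perfect matching of the triphenylene: the incoming walls of the centre and,
    for each outer hexagon, the two incoming walls other than the one shared with the
    centre.\<close>
  define A where "A = {wall q p | q p. fw q p \<and> (p = s \<or> (fw s p \<and> q \<noteq> s))}"
  have AF: "A \<subseteq> HE F" unfolding A_def using wall_in_HE sF t by blast
  have A_fan: "e \<subseteq> fan_verts s" if "e \<in> A" for e
    using that unfolding A_def wall_def fan_verts_def by blast
  have A_ex: "\<exists>e. e \<in> A \<and> v \<in> e" if v: "v \<in> fan_verts s" for v
  proof (cases "v \<in> hexverts s")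
    case True
    then obtain q where "fw q s" "v \<in> wall q s" using in_cover by blast
    then show ?thesis unfolding A_def by blast
  next
    case False
    then obtain u where u: "fw s u" "v \<in> hexverts u" using v unfolding fan_verts_def by blast
    obtain q where q: "fw q u" "v \<in> wall q u" using in_cover[OF u(2)] .
    have "q \<noteq> s" using q(2) False unfolding wall_def by blast
    then show ?thesis using q u(1) unfolding A_def by blast
  qed
  \<comment> \<open>A vertex shared by the centre and an outer hexagon is covered by their common
    wall, so the other incoming walls of the outer hexagon avoid the centre.\<close>
  have not_s: False if "fw q p" "fw s p" "q \<noteq> s" "v \<in> wall q p" "v \<in> hexverts s" for q p v
  proof -
    have "v \<in> wall s p" using that(4,5) unfolding wall_def by blast
    then show False using in_unique[OF that(1,2,4)] that(3) by blast
  qed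
  have A_uniq: "e = e'" if e: "e \<in> A" "e' \<in> A" "v \<in> e" "v \<in> e'" for e e' v
  proof -
    obtain q p where qp: "e = wall q p" "fw q p" "p = s \<or> (fw s p \<and> q \<noteq> s)"
      using e(1) unfolding A_def by blast
    obtain q' p' where qp': "e' = wall q' p'" "fw q' p'" "p' = s \<or> (fw s p' \<and> q' \<noteq> s)"
      using e(2) unfolding A_def by blast
    have v: "v \<in> hexverts p" "v \<in> hexverts p'" using e(3,4) qp(1) qp'(1) unfolding wall_def by blast+
    have "p = p'"
    proof (rule ccontr)
      assume "p \<noteq> p'"
      then consider "p = s" "fw s p'" "q' \<noteq> s" | "p' = s" "fw s p" "q \<noteq> s" | "fw s p" "fw s p'"
        using qp(3) qp'(3) by blast
      then show False
      proof cases
        case 1 then show False using not_s[of q' p' v] qp'(1,2) e(4) v by blast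
      next
        case 2 then show False using not_s[of q p v] qp(1,2) e(3) v by blast
      next
        case 3 then show False using out_hexes_disjoint[of s p p'] \<open>p \<noteq> p'\<close> v by blast
      qed
    qed
    then show ?thesis using in_unique[of q p q' v] qp(1,2) qp'(1,2) e(3,4) by simp
  qed
  have "perfect_matching (HV F) (HE F) (M0 \<union> A)"
    unfolding perfect_matching_def
  proof (intro conjI ballI)
    show "M0 \<union> A \<subseteq> HE F" using M0 AF by blast
    fix v assume v: "v \<in> HV F"
    show "\<exists>!e. e \<in> M0 \<union> A \<and> v \<in> e"
    proof (cases "v \<in> fan_verts s")
      case True
      then have "e \<notin> M0" if "v \<in> e" for e using M0 that by blast
      moreover obtain e where "e \<in> A" "v \<in> e" using A_ex[OF True] by blast
      ultimately show ?thesis using A_uniq[of _ e v] by blast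
    next
      case False
      then have "e \<notin> A" if "v \<in> e" for e using A_fan that by blast
      then show ?thesis using M0_ex1[OF v False] by blast
    qed
  qed
  moreover have "isolated_source F (M0 \<union> A) s"
    unfolding isolated_source_def source_def
    using sF t unfolding A_def by blast
  ultimately show thesis using that by blast
qed

lemma card_out: "card {t. fw s t} = 3"
proof -
  obtain a b where s: "s = (a, b)" by (cases s)
  have "{t. fwd s t} = {(a + 1, b), (a - 1, b + 1), (a, b - 1)}"
    "{t. fwd t s} = {(a - 1, b), (a + 1, b - 1), (a, b + 1)}"
    unfolding s fwd_out fwd_in by auto
  then have "card {t. fwd s t} = 3" "card {t. fwd t s} = 3" by simp_all
  then show ?thesis using fw_cases by (elim disjE) simp_all
qed

lemma fw_adjacent: "fw p q \<Longrightarrow> fwd p q \<or> fwd q p"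
  using fw_cases by (elim disjE) simp_all

lemma triphenylene_if_out:
  assumes "{t. fw s t} = {t1, t2, t3}"
  shows "triphenylene s t1 t2 t3"
proof -
  have fw: "fw s t1" "fw s t2" "fw s t3" using assms by blast+
  have "card {t1, t2, t3} = 3" using card_out[of s] assms by simp
  then have ne: "t1 \<noteq> t2" "t1 \<noteq> t3" "t2 \<noteq> t3" by (auto simp: card_insert_if split: if_splits)
  have "wall s t1 \<inter> wall s t2 = {}" "wall s t1 \<inter> wall s t3 = {}" "wall s t2 \<inter> wall s t3 = {}"
    using out_hexes_disjoint fw ne unfolding wall_def by blast+
  then show ?thesis
    unfolding triphenylene_def
    by (intro exI[of _ "wall s t1"] exI[of _ "wall s t2"] exI[of _ "wall s t3"]
        conjI hexedges_Int fw_adjacent fw)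
qed

lemma isolated_source_imp_nice_triphenylene:
  assumes M: "perfect_matching (HV F) (HE F) M" and s: "isolated_source F M s"
  shows "has_nice_triphenylene F"
proof -
  obtain t1 t2 t3 where t: "{t. fw s t} = {t1, t2, t3}"
    using card_out[of s] by (auto simp: card_3_iff)
  have X: "hexverts s \<union> hexverts t1 \<union> hexverts t2 \<union> hexverts t3 = fan_verts s"
    unfolding fan_verts_def t by blast
  have F: "s \<in> F" "t1 \<in> F" "t2 \<in> F" "t3 \<in> F"
    using s t unfolding isolated_source_def by blast+
  show ?thesis
    unfolding has_nice_triphenylene_def Let_def del_verts_V_def del_verts_E_def
    by (rule exI[of _ s], rule exI[of _ t1], rule exI[of _ t2], rule exI[of _ t3], unfold X)
      (intro conjI F triphenylene_if_out[OF t] isolated_source_nice[OF assms])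
qed

end

text \<open>An in-neighbour of \<open>h\<close> is adjacent to two of the three out-neighbours,
  hence to one of any two.\<close>

lemma two_outs_one_in:
  assumes "fwd h q" "fwd h q'" "q \<noteq> q'" "fwd r h"
  shows "fwd q r \<or> fwd q' r"
proof -
  obtain a b where h: "h = (a, b)" by (cases h)
  have "r = (a - 1, b) \<or> r = (a + 1, b - 1) \<or> r = (a, b + 1)"
    using assms(4) unfolding h fwd_in .
  moreover have "q = (a + 1, b) \<or> q = (a - 1, b + 1) \<or> q = (a, b - 1)"
    "q' = (a + 1, b) \<or> q' = (a - 1, b + 1) \<or> q' = (a, b - 1)"
    using assms(1,2) unfolding h fwd_out .
  ultimately show ?thesis
    using assms(3) by (elim disjE; simp add: fwd_def)
qed

lemma two_ins_one_out:
  assumes "fwd q h" "fwd q' h" "q \<noteq> q'" "fwd h r"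
  shows "fwd r q \<or> fwd r q'"
proof -
  obtain a b where h: "h = (a, b)" by (cases h)
  have "r = (a + 1, b) \<or> r = (a - 1, b + 1) \<or> r = (a, b - 1)"
    using assms(4) unfolding h fwd_out .
  moreover have "q = (a - 1, b) \<or> q = (a + 1, b - 1) \<or> q = (a, b + 1)"
    "q' = (a - 1, b) \<or> q' = (a + 1, b - 1) \<or> q' = (a, b + 1)"
    using assms(1,2) unfolding h fwd_in .
  ultimately show ?thesis
    using assms(3) by (elim disjE; simp add: fwd_def)
qed

text \<open>Walls of \<open>h\<close> to adjacent neighbours share a vertex, so three disjoint ones
  cannot mix in- and out-neighbours. This decides which orientation has the outer hexagons as
  out-neighbours of \<open>h\<close>.\<close>

lemma triphenylene_out_or_in:
  assumes "triphenylene h h1 h2 h3"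
  shows "{t. fwd h t} = {h1, h2, h3} \<or> {t. fwd t h} = {h1, h2, h3}"
proof -
  obtain e1 e2 e3 where e: "hexedges h \<inter> hexedges h1 = {e1}" "hexedges h \<inter> hexedges h2 = {e2}"
      "hexedges h \<inter> hexedges h3 = {e3}" "e1 \<inter> e2 = {}" "e1 \<inter> e3 = {}" "e2 \<inter> e3 = {}"
    using assms unfolding triphenylene_def by (elim exE conjE) (rule that; assumption)
  have adj: "(fwd h c \<or> fwd c h) \<and> e = wall h c" if c: "hexedges h \<inter> hexedges c = {e}" for c e
  proof -
    have "h \<noteq> c"
    proof
      assume "h = c"
      then have one: "hexedges h = {e}" using c by simp
      obtain q q' where q: "fwd h q" "fwd h q'" "q \<noteq> q'"
        by (rule that[of "(fst h + 1, snd h)" "(fst h, snd h - 1)"]) (simp_all add: fwd_def)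
      then have "wall h q \<in> hexedges h" "wall h q' \<in> hexedges h"
        unfolding hexedges_eq by blast+
      then have "wall h q = wall h q'" using one by blast
      then show False using wall_inject[OF q(1,2)] q(3) by blast
    qed
    then have adj: "fwd h c \<or> fwd c h" using c hex_adj_fwd[of h c] unfolding hex_adj_def by simp
    then have "{e} = {wall h c}" using hexedges_Int[of h c] c by simp
    then show ?thesis using adj by simp
  qed
  have wall: "e1 = wall h h1" "e2 = wall h h2" "e3 = wall h h3"
    and io: "fwd h h1 \<or> fwd h1 h" "fwd h h2 \<or> fwd h2 h" "fwd h h3 \<or> fwd h3 h"
    using adj[OF e(1)] adj[OF e(2)] adj[OF e(3)] by simp_all
  have meet: "wall h q \<inter> wall h r \<noteq> {}" if qr: "fwd h q" "fwd r h" "fwd q r" for q r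
  proof -
    have "forward.tri h q r" using qr unfolding forward.tri_def by blast
    then obtain v where "hexverts h \<inter> hexverts q \<inter> hexverts r = {v}"
      using forward.tri_vertex by blast
    then show ?thesis unfolding wall_def by blast
  qed
  have no1: False if q: "fwd h q" "fwd h q'" "fwd r h" and d: "wall h q \<inter> wall h q' = {}"
      "wall h q \<inter> wall h r = {}" "wall h q' \<inter> wall h r = {}" for q q' r
  proof -
    have "wall h q \<noteq> {}" using wall_nonempty q(1) by blast
    then have "q \<noteq> q'" using d(1) by blast
    then have "fwd q r \<or> fwd q' r" using two_outs_one_in q by blast
    then show False using meet d(2,3) q by blast
  qed
  have no2: False if q: "fwd q h" "fwd q' h" "fwd h r" and d: "wall h q \<inter> wall h q' = {}"
      "wall h q \<inter> wall h r = {}" "wall h q' \<inter> wall h r = {}" for q q' r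
  proof -
    have "wall h q \<noteq> {}" using wall_nonempty q(1) wall_commute by metis
    then have "q \<noteq> q'" using d(1) by blast
    then have "fwd r q \<or> fwd r q'" using two_ins_one_out q by blast
    then show False using meet[OF q(3,1)] meet[OF q(3,2)] d(2,3) by blast
  qed
  have d: "wall h h1 \<inter> wall h h2 = {}" "wall h h1 \<inter> wall h h3 = {}" "wall h h2 \<inter> wall h h3 = {}"
    "wall h h2 \<inter> wall h h1 = {}" "wall h h3 \<inter> wall h h1 = {}" "wall h h3 \<inter> wall h h2 = {}"
    using e(4-6) unfolding wall by blast+
  have "wall h h1 \<noteq> {}" "wall h h2 \<noteq> {}" "wall h h3 \<noteq> {}"
    using io wall_nonempty wall_commute by metis+
  then have ne: "h1 \<noteq> h2" "h1 \<noteq> h3" "h2 \<noteq> h3" using d by blast+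
  have card3: "card {h1, h2, h3} = 3" using ne by simp
  have "fwd h h1 \<and> fwd h h2 \<and> fwd h h3 \<or> fwd h1 h \<and> fwd h2 h \<and> fwd h3 h"
    using io no1[of h1 h2 h3] no1[of h1 h3 h2] no1[of h2 h3 h1]
      no2[of h1 h2 h3] no2[of h1 h3 h2] no2[of h2 h3 h1] d by blast
  then show ?thesis
  proof
    assume "fwd h h1 \<and> fwd h h2 \<and> fwd h h3"
    then have "{h1, h2, h3} = {t. fwd h t}"
      using card3 forward.card_out[of h] forward.finite_out[of h]
      by (intro card_subset_eq) auto
    then show ?thesis by simp
  next
    assume "fwd h1 h \<and> fwd h2 h \<and> fwd h3 h"
    then have "{h1, h2, h3} = {t. fwd t h}"
      using card3 backward.card_out[of h] backward.finite_out[of h]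
      by (intro card_subset_eq) auto
    then show ?thesis by simp
  qed
qed

lemma nice_triphenylene_imp_fr_less_af:
  assumes "finite F" "has_nice_triphenylene F"
  obtains M where "perfect_matching (HV F) (HE F) M" "fr F M < af F M"
proof -
  obtain h h1 h2 h3 where hF: "h \<in> F" "h1 \<in> F" "h2 \<in> F" "h3 \<in> F" and t: "triphenylene h h1 h2 h3"
    and pm: "has_pm (HV F - (hexverts h \<union> hexverts h1 \<union> hexverts h2 \<union> hexverts h3))
      {e \<in> HE F. e \<inter> (hexverts h \<union> hexverts h1 \<union> hexverts h2 \<union> hexverts h3) = {}}"
    using assms(2) unfolding has_nice_triphenylene_def Let_def del_verts_V_def del_verts_E_def by blast
  from triphenylene_out_or_in[OF t] show thesis
  proof
    assume out: "{t. fwd h t} = {h1, h2, h3}"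
    have "hexverts h \<union> hexverts h1 \<union> hexverts h2 \<union> hexverts h3 = forward.fan_verts h"
      unfolding forward.fan_verts_def out by blast
    moreover have "t \<in> F" if "fwd h t" for t
    proof -
      have "t \<in> {h1, h2, h3}" unfolding out[symmetric] using that by simp
      then show ?thesis using hF by blast
    qed
    ultimately obtain M where "perfect_matching (HV F) (HE F) M" "forward.isolated_source F M h"
      using forward.nice_imp_isolated_source[OF hF(1)] pm by metis
    then show thesis
      using forward.fr_less_af_if_isolated_source[OF assms(1)] that by blast
  next
    assume out: "{t. fwd t h} = {h1, h2, h3}"
    have "hexverts h \<union> hexverts h1 \<union> hexverts h2 \<union> hexverts h3 = backward.fan_verts h"
      unfolding backward.fan_verts_def out by blast
    moreover have "t \<in> F" if "fwd t h" for t
    proof -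
      have "t \<in> {h1, h2, h3}" unfolding out[symmetric] using that by simp
      then show ?thesis using hF by blast
    qed
    ultimately obtain M where "perfect_matching (HV F) (HE F) M" "backward.isolated_source F M h"
      using backward.nice_imp_isolated_source[OF hF(1)] pm by metis
    then show thesis
      using backward.fr_less_af_if_isolated_source[OF assms(1)] that by blast
  qed
qed

theorem theorem4p2:
  assumes "hexsys F"
    and "has_pm (HV F) (HE F)"
  shows "\<not> has_nice_triphenylene F \<longleftrightarrow>
         (\<forall>M. perfect_matching (HV F) (HE F) M \<longrightarrow> af F M = fr F M)"
proof
  assume nice: "\<not> has_nice_triphenylene F"
  show "\<forall>M. perfect_matching (HV F) (HE F) M \<longrightarrow> af F M = fr F M"
  proof (intro allI impI)
    fix M assume M: "perfect_matching (HV F) (HE F) M"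
    show "af F M = fr F M"
    proof (rule af_eq_fr_if_not_stuck[OF assms(1) M])
      show "\<not> forward.stuck F M V" for V
        using forward.stuck_imp_isolated_source[OF assms(1) M]
          forward.isolated_source_imp_nice_triphenylene nice by blast
      show "\<not> backward.stuck F M V" for V
        using backward.stuck_imp_isolated_source[OF assms(1) M]
          backward.isolated_source_imp_nice_triphenylene nice by blast
    qed
  qed
next
  assume eq: "\<forall>M. perfect_matching (HV F) (HE F) M \<longrightarrow> af F M = fr F M"
  have "finite F" using assms(1) unfolding hexsys_def by blast
  then show "\<not> has_nice_triphenylene F"
    using nice_triphenylene_imp_fr_less_af[of F] eq by (metis less_irrefl)
qed

end
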